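(* For a random variable $F\in L^2_{\mathbb{X}}$ the following conditions are equivalent: (i) $F\in\operatorname{dom}(D)$. (ii) $(D_kF)_{k\in\mathbb{N}}\in L^2(\kappa\otimes\mathbb{P}_{\mathcal{F}})$, i.e. $\sum_{k=1}^\infty\mathbb{E}[(D_kF)^2]<\infty$. (iii) For one (and then every) representative $f\in L^2(\mu)$ of $F$ one has $\displaystyle\sum_{k=1}^\infty\mathbb{E}\Bigl[\bigl(f(\mathbb{X}^{(k)})-f(\mathbb{X})\bigr)^2\Bigr]<\infty$. (iv) With the infinite Hoeffding decomposition $F=\sum_{M\in\mathcal{P}_{fin}(\mathbb{N})}F_M=\sum_{p=0}^\infty F^{(p)}$ one has that $$\sum_{p=1}^\infty p\,\mathbb{E}\bigl[(F^{(p)})^2\bigr]=\sum_{p=1}^\infty p\,\mathbb{E}\bigl[J_p(F)^2\bigr]=\sum_{M\in\mathcal{P}_{fin}(\mathbb{N})}|M|\,\mathbb{E}[F_M^2]<\infty.$$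
   Context: $\mathbb{N}=\{1,2,\ldots\}$ and $\mathcal{P}_{fin}(\mathbb{N})$ is the collection of finite subsets of $\mathbb{N}$. Let $(E_n,\mathcal{B}_n,\mu_n)$, $n\in\mathbb{N}$, be arbitrary probability spaces with product $(E,\mathcal{B},\mu)$. On a probability space $(\Omega,\mathcal{A},\mathbb{P})$ let $\mathbb{X}=(X_n)_{n\in\mathbb{N}}$ and $\mathbb{X}'=(X_n')_{n\in\mathbb{N}}$ be two independent $E$-valued random sequences, each with distribution $\mu$. For $k\in\mathbb{N}$, $\mathbb{X}^{(k)}$ denotes the sequence $\mathbb{X}$ with its $k$-th coordinate $X_k$ replaced by $X_k'$. Let $\mathcal{F}=\sigma(\mathbb{X})$, $\mathbb{P}_{\mathcal{F}}$ the restriction of $\mathbb{P}$ to $\mathcal{F}$, $L^2_{\mathbb{X}}=L^2(\Omega,\mathcal{F},\mathbb{P})$ (real-valued), and let $\kappa$ be the counting measure on $\mathbb{N}$. Elements of $L^2(\kappa\otimes\mathbb{P}_{\mathcal{F}})$ are identified with sequences $(U_k)_{k\in\mathbb{N}}$ of $\mathcal{F}$-measurable random variables. For $M\subseteq\mathbb{N}$ let $\mathcal{F}_M=\sigma(X_j,j\in M)$ and let $\mathcal{G}_k=\sigma(X_j,j\neq k)$. A representative of $F\in L^2_{\mathbb{X}}$ is a function $f\in L^2(\mu)$ with $F=f(\mathbb{X})$ (it exists and is $\mu$-a.s. unique). Infinite Hoeffding decomposition: for $F\in L^2_{\mathbb{X}}$ and $M\in\mathcal{P}_{fin}(\mathbb{N})$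 put $F_M:=\sum_{L\subseteq M}(-1)^{|M|-|L|}\mathbb{E}[F\,|\,\mathcal{F}_L]$, and $F^{(p)}=J_p(F):=\sum_{|M|=p}F_M$ for $p\in\mathbb{N}_0=\{0,1,2,\ldots\}$. Then $F=\sum_{M\in\mathcal{P}_{fin}(\mathbb{N})}F_M=\sum_{p=0}^\infty F^{(p)}$, where all series converge unconditionally in $L^2(\mathbb{P})$ and have orthogonal summands. $J_p$ is the orthogonal projection onto the $p$-th Hoeffding space $\mathcal{H}_p=\{F\in L^2_{\mathbb{X}}:F=F^{(p)}\}$. Malliavin derivative: for $F\in L^2_{\mathbb{X}}$, $D_kF:=F-\mathbb{E}[F\,|\,\mathcal{G}_k]$. Let $\mathcal{S}\subseteq L^2_{\mathbb{X}}$ be the dense subspace of cylindrical random variables, i.e. those that are $\sigma(X_1,\dotsc,X_n)$-measurable for some $n\in\mathbb{N}$. On $\mathcal{S}$ define $DF:=(D_kF)_{k\in\mathbb{N}}\in L^2(\kappa\otimes\mathbb{P}_{\mathcal{F}})$. This operator is closable as an operator from $L^2_{\mathbb{X}}$ to $L^2(\kappa\otimes\mathbb{P}_{\mathcal{F}})$; its closure is again denoted by $D$ and $\operatorname{dom}(D)$ is the domain of the closure. *)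

theory Defs
  imports "HOL-Probability.Probability"
begin

(* Conventions.  Sequences are indexed by the type nat, so the index set {1, 2, ...} is shifted to
   {0, 1, ...}.  The factor spaces are mu n :: 'a measure, and X :: 'w => nat => 'a is the random
   sequence, with k-th coordinate \<lambda>\<omega>. X \<omega> k.  Elements of L^2-spaces are represented by functions,
   equality of elements being equality almost everywhere.  Expectations of squares are
   nonnegative Lebesgue integrals, hence [0,\<infinity>]-valued. *)

definition L2 :: "'x measure \<Rightarrow> ('x \<Rightarrow> real) set" where
  "L2 M = {f \<in> borel_measurable M. integrable M (\<lambda>x. (f x)\<^sup>2)}"

definition L2_dist_sq :: "'x measure \<Rightarrow> ('x \<Rightarrow> real) \<Rightarrow> ('x \<Rightarrow> real) \<Rightarrow> ennreal" where
  "L2_dist_sq M f g = (\<integral>\<^sup>+x. ennreal ((f x - g x)\<^sup>2) \<partial>M)"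

text \<open>Unconditional convergence in \<open>L\<^sup>2\<close> of the series of the \<open>f i\<close>, \<open>i \<in> A\<close>, with sum \<open>s\<close>;
  the counterpart of \<^const>\<open>has_sum\<close>.\<close>

definition L2_has_sum :: "'x measure \<Rightarrow> ('i \<Rightarrow> 'x \<Rightarrow> real) \<Rightarrow> 'i set \<Rightarrow> ('x \<Rightarrow> real) \<Rightarrow> bool" where
  "L2_has_sum M f A s \<longleftrightarrow>
     s \<in> L2 M \<and>
     ((\<lambda>S. L2_dist_sq M (\<lambda>x. \<Sum>i\<in>S. f i x) s) \<longlongrightarrow> 0) (finite_subsets_at_top A)"

definition sigma_coords ::
    "'w measure \<Rightarrow> (nat \<Rightarrow> 'a measure) \<Rightarrow> ('w \<Rightarrow> nat \<Rightarrow> 'a) \<Rightarrow> nat set \<Rightarrow> 'w measure" where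
  "sigma_coords P \<mu> X M =
     sigma (space P) (\<Union>j\<in>M. {(\<lambda>\<omega>. X \<omega> j) -` A \<inter> space P |A. A \<in> sets (\<mu> j)})"

text \<open>The probability space \<open>(\<Omega>, \<sigma>(X), P\<^sub>F)\<close>.\<close>

definition P_X :: "'w measure \<Rightarrow> (nat \<Rightarrow> 'a measure) \<Rightarrow> ('w \<Rightarrow> nat \<Rightarrow> 'a) \<Rightarrow> 'w measure" where
  "P_X P \<mu> X = restr_to_subalg P (vimage_algebra (space P) X (PiM UNIV \<mu>))"

definition L2_X :: "'w measure \<Rightarrow> (nat \<Rightarrow> 'a measure) \<Rightarrow> ('w \<Rightarrow> nat \<Rightarrow> 'a) \<Rightarrow> ('w \<Rightarrow> real) set" where
  "L2_X P \<mu> X = L2 (P_X P \<mu> X)"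

definition kappa_P_X ::
    "'w measure \<Rightarrow> (nat \<Rightarrow> 'a measure) \<Rightarrow> ('w \<Rightarrow> nat \<Rightarrow> 'a) \<Rightarrow> (nat \<times> 'w) measure" where
  "kappa_P_X P \<mu> X = count_space UNIV \<Otimes>\<^sub>M P_X P \<mu> X"

definition representative ::
    "'w measure \<Rightarrow> (nat \<Rightarrow> 'a measure) \<Rightarrow> ('w \<Rightarrow> nat \<Rightarrow> 'a) \<Rightarrow> ('w \<Rightarrow> real) \<Rightarrow>
     ((nat \<Rightarrow> 'a) \<Rightarrow> real) \<Rightarrow> bool" where
  "representative P \<mu> X F f \<longleftrightarrow> f \<in> L2 (PiM UNIV \<mu>) \<and> (AE \<omega> in P. F \<omega> = f (X \<omega>))"

definition Hoeffding_component ::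
    "'w measure \<Rightarrow> (nat \<Rightarrow> 'a measure) \<Rightarrow> ('w \<Rightarrow> nat \<Rightarrow> 'a) \<Rightarrow> ('w \<Rightarrow> real) \<Rightarrow> nat set \<Rightarrow>
     'w \<Rightarrow> real" where
  "Hoeffding_component P \<mu> X F M =
     (\<lambda>\<omega>. \<Sum>L\<in>Pow M. (-1) ^ (card M - card L) * real_cond_exp P (sigma_coords P \<mu> X L) F \<omega>)"

text \<open>The \<open>L\<^sup>2\<close>-sum is only determined almost surely, hence the choice of a version.\<close>

definition Hoeffding_proj ::
    "'w measure \<Rightarrow> (nat \<Rightarrow> 'a measure) \<Rightarrow> ('w \<Rightarrow> nat \<Rightarrow> 'a) \<Rightarrow> nat \<Rightarrow> ('w \<Rightarrow> real) \<Rightarrow>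
     'w \<Rightarrow> real" where
  "Hoeffding_proj P \<mu> X p F =
     (SOME G. L2_has_sum (P_X P \<mu> X) (Hoeffding_component P \<mu> X F) {M. finite M \<and> card M = p} G)"

definition Dk ::
    "'w measure \<Rightarrow> (nat \<Rightarrow> 'a measure) \<Rightarrow> ('w \<Rightarrow> nat \<Rightarrow> 'a) \<Rightarrow> nat \<Rightarrow> ('w \<Rightarrow> real) \<Rightarrow>
     'w \<Rightarrow> real" where
  "Dk P \<mu> X k F = (\<lambda>\<omega>. F \<omega> - real_cond_exp P (sigma_coords P \<mu> X (UNIV - {k})) F \<omega>)"

definition D_seq ::
    "'w measure \<Rightarrow> (nat \<Rightarrow> 'a measure) \<Rightarrow> ('w \<Rightarrow> nat \<Rightarrow> 'a) \<Rightarrow> ('w \<Rightarrow> real) \<Rightarrow>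
     nat \<times> 'w \<Rightarrow> real" where
  "D_seq P \<mu> X F = (\<lambda>(k, \<omega>). Dk P \<mu> X k F \<omega>)"

definition cylindrical ::
    "'w measure \<Rightarrow> (nat \<Rightarrow> 'a measure) \<Rightarrow> ('w \<Rightarrow> nat \<Rightarrow> 'a) \<Rightarrow> ('w \<Rightarrow> real) set" where
  "cylindrical P \<mu> X =
     {F \<in> L2_X P \<mu> X. \<exists>n. F \<in> borel_measurable (sigma_coords P \<mu> X {..<n})}"

definition D_graph ::
    "'w measure \<Rightarrow> (nat \<Rightarrow> 'a measure) \<Rightarrow> ('w \<Rightarrow> nat \<Rightarrow> 'a) \<Rightarrow>
     (('w \<Rightarrow> real) \<times> (nat \<times> 'w \<Rightarrow> real)) set" where
  "D_graph P \<mu> X = {(F, D_seq P \<mu> X F) |F. F \<in> cylindrical P \<mu> X}"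

text \<open>The (sequential) closure of the graph in the product of the two \<open>L\<^sup>2\<close>-spaces, i.e. the graph of the
  closure of the operator \<open>D\<close>.\<close>

definition D_closure_graph ::
    "'w measure \<Rightarrow> (nat \<Rightarrow> 'a measure) \<Rightarrow> ('w \<Rightarrow> nat \<Rightarrow> 'a) \<Rightarrow>
     (('w \<Rightarrow> real) \<times> (nat \<times> 'w \<Rightarrow> real)) set" where
  "D_closure_graph P \<mu> X =
     {(F, U). F \<in> L2_X P \<mu> X \<and> U \<in> L2 (kappa_P_X P \<mu> X) \<and>
        (\<exists>G V. (\<forall>n. (G n, V n) \<in> D_graph P \<mu> X) \<and>
               (\<lambda>n::nat. L2_dist_sq (P_X P \<mu> X) (G n) F) \<longlonglongrightarrow> 0 \<and>
               (\<lambda>n. L2_dist_sq (kappa_P_X P \<mu> X) (V n) U) \<longlonglongrightarrow> 0)}"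

definition dom_D ::
    "'w measure \<Rightarrow> (nat \<Rightarrow> 'a measure) \<Rightarrow> ('w \<Rightarrow> nat \<Rightarrow> 'a) \<Rightarrow> ('w \<Rightarrow> real) set" where
  "dom_D P \<mu> X = Domain (D_closure_graph P \<mu> X)"

end

(* By independence, E[E[F|F_K]|F_L] = E[F|F_(K Int L)], so everything is governed by the set function
   q(L) = E[E[F|F_L]^2]: one has E[(D_k F)^2] = q(N) - q(N - {k}), resampling the k-th coordinate
   gives twice this value, and the Hoeffding components are orthogonal with squared norms c(M), the
   Moebius transform of q.  Since E[F|F_{0..<n}] converges to F, q(N) is the sum of c(M) over the
   finite subsets M of N, whence E[(D_k F)^2] is the sum of c(M) over the M containing k.  Summing
   over k turns (ii) into the sum of |M| c(M), which is (iv).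
   For (i), the truncations E[F|F_{0..<n}] approximate F in the graph norm by dominated convergence
   of the sum over k; conversely, each D_k is an L^2-contraction, which bounds every partial sum of
   (ii) along an approximating sequence. *)

theory Submission
  imports Defs
begin

section \<open>The space \<open>L\<^sup>2\<close>\<close>

text \<open>The conditional expectations form a family of orthogonal projections indexed by sets of
  coordinates. Their composition rule is obtained by duality: once the projections are moved onto
  the indicator of a test event, only events have to be written as preimages under \<open>X\<close>,
  and for these an induction over the generators suffices. The explicit kernel is integration over a
  fresh copy of the coordinates that are averaged out. Three features shape the rest.
  \<open>Hoeffding_proj\<close> is chosen by \<open>SOME\<close>, so the unordered series has to be
  shown to converge before anything can be said about its sum; this calls for completeness of L^2.
  Energies are real, so that they can be subtracted, whereas the sums over \<open>k\<close>,
  \<open>p\<close> and \<open>M\<close> are taken in [0,\<infinity>], where they may be interchanged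
  before they are known to be finite; thus (ii) and both sums in (iv) are the same extended number,
  and (iii) is twice that number. Finally, \<open>D\<close> is in general unbounded, so in (i) a
  small L^2-error of F controls only finitely many derivatives at a time.\<close>

lemma L2_D:
  assumes "f \<in> L2 M"
  shows "f \<in> borel_measurable M" "integrable M (\<lambda>x. (f x)\<^sup>2)"
  using assms by (auto simp: L2_def)

lemma L2_mult_integrable:
  assumes "f \<in> L2 M" "g \<in> L2 M"
  shows "integrable M (\<lambda>x. f x * g x)"
proof (rule Bochner_Integration.integrable_bound)
  show "integrable M (\<lambda>x. (f x)\<^sup>2 + (g x)\<^sup>2)"
    using L2_D[OF assms(1)] L2_D[OF assms(2)] by simp
  show "(\<lambda>x. f x * g x) \<in> borel_measurable M"
    using L2_D[OF assms(1)] L2_D[OF assms(2)] by measurable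
  have "\<bar>f x * g x\<bar> \<le> (f x)\<^sup>2 + (g x)\<^sup>2" for x
  proof -
    have "2 * \<bar>f x * g x\<bar> \<le> (f x)\<^sup>2 + (g x)\<^sup>2"
      using sum_squares_bound[of "\<bar>f x\<bar>" "\<bar>g x\<bar>"] by (simp add: abs_mult)
    then show ?thesis using abs_ge_zero[of "f x * g x"] by linarith
  qed
  then show "AE x in M. norm (f x * g x) \<le> norm ((f x)\<^sup>2 + (g x)\<^sup>2)"
    by simp
qed

lemma L2_add:
  assumes "f \<in> L2 M" "g \<in> L2 M"
  shows "(\<lambda>x. f x + g x) \<in> L2 M"
  using L2_D[OF assms(1)] L2_D[OF assms(2)] L2_mult_integrable[OF assms]
  by (auto simp: L2_def power2_sum mult.assoc)

lemma L2_cmult: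
  assumes "f \<in> L2 M"
  shows "(\<lambda>x. c * f x) \<in> L2 M"
  using L2_D[OF assms] by (auto simp: L2_def power_mult_distrib)

lemma L2_diff:
  assumes "f \<in> L2 M" "g \<in> L2 M"
  shows "(\<lambda>x. f x - g x) \<in> L2 M"
  using L2_add[OF assms(1) L2_cmult[OF assms(2), of "-1"]] by simp

lemma L2_sum:
  assumes "\<And>i. i \<in> A \<Longrightarrow> f i \<in> L2 M"
  shows "(\<lambda>x. \<Sum>i\<in>A. f i x) \<in> L2 M"
proof (cases "finite A")
  case True
  then show ?thesis using assms
  proof induction
    case empty show ?case by (simp add: L2_def)
  next
    case (insert i A) then show ?case by (simp add: L2_add)
  qed
qed (simp add: L2_def)

lemma nn_integral_square_L2:
  assumes "f \<in> L2 M"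
  shows "(\<integral>\<^sup>+x. ennreal ((f x)\<^sup>2) \<partial>M) = ennreal (\<integral>x. (f x)\<^sup>2 \<partial>M)"
  using L2_D[OF assms] by (intro nn_integral_eq_integral) auto

lemma L2_iff_nn_integral:
  "f \<in> L2 M \<longleftrightarrow> f \<in> borel_measurable M \<and> (\<integral>\<^sup>+x. ennreal ((f x)\<^sup>2) \<partial>M) < \<infinity>"
  by (auto simp: L2_def integrable_iff_bounded)

lemma L2_dist_sq_eq:
  assumes "f \<in> L2 M" "g \<in> L2 M"
  shows "L2_dist_sq M f g = ennreal (\<integral>x. (f x - g x)\<^sup>2 \<partial>M)"
  unfolding L2_dist_sq_def by (rule nn_integral_square_L2[OF L2_diff[OF assms]])

lemma square_sum_le: "((a::real) + b)\<^sup>2 \<le> 2 * a\<^sup>2 + 2 * b\<^sup>2"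
  using sum_squares_bound[of a b] by (simp add: power2_sum)

lemma L2_norm_add_le:
  assumes "f \<in> L2 M" "g \<in> L2 M"
  shows "(\<integral>x. (f x + g x)\<^sup>2 \<partial>M) \<le> 2 * (\<integral>x. (f x)\<^sup>2 \<partial>M) + 2 * (\<integral>x. (g x)\<^sup>2 \<partial>M)"
proof -
  have "(\<integral>x. (f x + g x)\<^sup>2 \<partial>M) \<le> (\<integral>x. 2 * (f x)\<^sup>2 + 2 * (g x)\<^sup>2 \<partial>M)"
    using L2_D[OF assms(1)] L2_D[OF assms(2)] L2_D[OF L2_add[OF assms]]
    by (intro integral_mono) (auto simp: square_sum_le)
  then show ?thesis using L2_D[OF assms(1)] L2_D[OF assms(2)] by simp
qed

text \<open>Riesz-Fischer for an arbitrary measure. Along a fast subsequence the squared increments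
  remain summable after weighting by 2^j, which gives convergence almost everywhere; Fatou's lemma
  turns the pointwise limit into an L^2-limit of the whole sequence.\<close>

theorem L2_complete:
  fixes f :: "nat \<Rightarrow> 'x \<Rightarrow> real"
  assumes f: "\<And>n. f n \<in> L2 M"
    and Cauchy: "\<And>e. e > 0 \<Longrightarrow> \<exists>N. \<forall>m\<ge>N. \<forall>n\<ge>N. (\<integral>x. (f m x - f n x)\<^sup>2 \<partial>M) < e"
  obtains g where "g \<in> L2 M" "(\<lambda>n. \<integral>x. (f n x - g x)\<^sup>2 \<partial>M) \<longlonglongrightarrow> 0"
proof -
  have [measurable]: "f n \<in> borel_measurable M" for n using L2_D[OF f] by simp
  have "\<forall>j. \<exists>N. \<forall>m\<ge>N. \<forall>n\<ge>N. (\<integral>x. (f m x - f n x)\<^sup>2 \<partial>M) < (1/4)^j"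
    by (intro allI Cauchy) simp
  then obtain N where N: "\<And>j m n. m \<ge> N j \<Longrightarrow> n \<ge> N j \<Longrightarrow> (\<integral>x. (f m x - f n x)\<^sup>2 \<partial>M) < (1/4)^j"
    by metis
  \<comment> \<open>Summing all thresholds up to \<open>j\<close> makes \<open>r\<close>
    nondecreasing and at least \<open>N j\<close>; the extra \<open>j\<close> gives
    \<open>r j \<ge> j\<close>, so the subsequence passes every index.\<close>
  define r where "r j = (\<Sum>i\<le>j. N i) + j" for j
  have rN: "N j \<le> r j" for j
    unfolding r_def by (intro trans_le_add1 member_le_sum) auto
  have rSuc: "r j \<le> r (Suc j)" for j unfolding r_def by simp
  define d where "d j x = f (r (Suc j)) x - f (r j) x" for j x
  have [measurable]: "d j \<in> borel_measurable M" for j unfolding d_def by measurable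
  have dL2: "d j \<in> L2 M" for j unfolding d_def by (intro L2_diff f)
  have d: "(\<integral>x. (d j x)\<^sup>2 \<partial>M) < (1/4)^j" for j
    unfolding d_def using rN[of j] rSuc[of j] by (intro N) auto
  have "(\<integral>\<^sup>+x. (\<Sum>j. ennreal (2^j * (d j x)\<^sup>2)) \<partial>M) = (\<Sum>j. \<integral>\<^sup>+x. ennreal (2^j * (d j x)\<^sup>2) \<partial>M)"
    by (rule nn_integral_suminf) measurable
  also have "\<dots> = (\<Sum>j. ennreal (2^j * (\<integral>x. (d j x)\<^sup>2 \<partial>M)))"
    by (intro suminf_cong, subst nn_integral_eq_integral) (use L2_D[OF dL2] in auto)
  also have "\<dots> \<le> (\<Sum>j. ennreal ((1/2)^j))"
  proof (intro suminf_le ennreal_leI)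
    fix j
    have "2^j * (\<integral>x. (d j x)\<^sup>2 \<partial>M) \<le> 2^j * (1/4)^j" using d[of j] by simp
    also have "\<dots> = (1/2::real)^j" by (simp flip: power_mult_distrib)
    finally show "2^j * (\<integral>x. (d j x)\<^sup>2 \<partial>M) \<le> (1/2)^j" .
  qed auto
  also have "\<dots> < \<infinity>"
    by (subst suminf_ennreal2) (auto simp: summable_geometric)
  finally have "AE x in M. (\<Sum>j. ennreal (2^j * (d j x)\<^sup>2)) \<noteq> \<infinity>"
    by (intro nn_integral_PInf_AE) auto
  then have conv: "AE x in M. convergent (\<lambda>j. f (r j) x)"
  proof eventually_elim
    case (elim x)
    have s1: "summable (\<lambda>j. 2^j * (d j x)\<^sup>2)"
      using elim by (intro summable_suminf_not_top) auto
    have "summable (\<lambda>j. d j x)"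
    proof (rule summable_comparison_test'[where N=0])
      show "summable (\<lambda>j. 2^j * (d j x)\<^sup>2 + (1/2)^j)"
        using s1 by (intro summable_add summable_geometric) auto
      fix j
      \<comment> \<open>Expanding this square and dividing by 2^j yields 2 |d| \<le> 2^j d^2 +
        2^(-j), a summable pointwise bound for the increments.\<close>
      have "0 \<le> (2^j * \<bar>d j x\<bar> - 1)\<^sup>2" by simp
      also have "\<dots> = 2^j * (2^j * (d j x)\<^sup>2 + (1/2)^j - 2 * \<bar>d j x\<bar>)"
        by (simp add: power2_eq_square algebra_simps power_one_over)
      finally have "0 \<le> 2^j * (d j x)\<^sup>2 + (1/2)^j - 2 * \<bar>d j x\<bar>"
        using mult_le_cancel_left_pos[of "2^j" 0 "2^j * (d j x)\<^sup>2 + (1/2)^j - 2 * \<bar>d j x\<bar>"]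
        by (simp only: mult_zero_right zero_less_power zero_less_numeral)
      then show "norm (d j x) \<le> 2^j * (d j x)\<^sup>2 + (1/2)^j" by simp
    qed
    then have "convergent (\<lambda>n. (\<Sum>j<n. d j x) + f (r 0) x)"
      by (intro convergent_add convergent_const) (simp add: summable_iff_convergent)
    moreover have "(\<Sum>j<n. d j x) + f (r 0) x = f (r n) x" for n
      by (induction n) (auto simp: d_def)
    ultimately show ?case by simp
  qed
  define g where "g x = lim (\<lambda>j. f (r j) x)" for x
  have [measurable]: "g \<in> borel_measurable M" unfolding g_def by measurable
  have lim: "AE x in M. (\<lambda>j. f (r j) x) \<longlonglongrightarrow> g x"
    using conv by eventually_elim (simp add: g_def convergent_LIMSEQ_iff)
  have bd: "\<exists>K. \<forall>n\<ge>K. (\<integral>\<^sup>+x. ennreal ((f n x - g x)\<^sup>2) \<partial>M) \<le> ennreal e" if "e > 0" for e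
  proof -
    obtain K where K: "\<And>m n. m \<ge> K \<Longrightarrow> n \<ge> K \<Longrightarrow> (\<integral>x. (f m x - f n x)\<^sup>2 \<partial>M) < e"
      using Cauchy[OF \<open>e > 0\<close>] by blast
    have "(\<integral>\<^sup>+x. ennreal ((f n x - g x)\<^sup>2) \<partial>M) \<le> ennreal e" if "n \<ge> K" for n
    proof -
      \<comment> \<open>For fixed \<open>n\<close> the subsequence is sent to its limit, so that
        Fatou's lemma transfers the Cauchy bound from \<open>f (r j)\<close> to
        \<open>g\<close>.\<close>
      have "AE x in M. ennreal ((f n x - g x)\<^sup>2) = liminf (\<lambda>j. ennreal ((f n x - f (r j) x)\<^sup>2))"
        using lim
      proof eventually_elim
        case (elim x)
        have "(\<lambda>j. ennreal ((f n x - f (r j) x)\<^sup>2)) \<longlonglongrightarrow> ennreal ((f n x - g x)\<^sup>2)"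
          by (intro tendsto_intros elim)
        from lim_imp_Liminf[OF sequentially_bot this] show ?case by simp
      qed
      then have "(\<integral>\<^sup>+x. ennreal ((f n x - g x)\<^sup>2) \<partial>M) = (\<integral>\<^sup>+x. liminf (\<lambda>j. ennreal ((f n x - f (r j) x)\<^sup>2)) \<partial>M)"
        by (intro nn_integral_cong_AE) auto
      also have "\<dots> \<le> liminf (\<lambda>j. \<integral>\<^sup>+x. ennreal ((f n x - f (r j) x)\<^sup>2) \<partial>M)"
        by (intro nn_integral_liminf) measurable
      also have "\<dots> \<le> ennreal e"
      proof (rule Liminf_le)
        have "eventually (\<lambda>j. j \<ge> K) sequentially" by (rule eventually_ge_at_top)
        then show "eventually (\<lambda>j. (\<integral>\<^sup>+x. ennreal ((f n x - f (r j) x)\<^sup>2) \<partial>M) \<le> ennreal e) sequentially"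
        proof eventually_elim
          case (elim j)
          then have "r j \<ge> K" by (simp add: r_def)
          then show ?case
            using K[OF \<open>n \<ge> K\<close>, of "r j"] nn_integral_square_L2[OF L2_diff[OF f f], of n "r j"]
            by (simp add: ennreal_leI)
        qed
      qed simp
      finally show ?thesis .
    qed
    then show ?thesis by blast
  qed
  \<comment> \<open>A single \<open>f K\<close> at finite distance from \<open>g\<close> already
    puts \<open>g\<close> into L^2.\<close>
  have "\<exists>K. \<forall>n\<ge>K. (\<integral>\<^sup>+x. ennreal ((f n x - g x)\<^sup>2) \<partial>M) \<le> ennreal 1" by (rule bd) simp
  then obtain K where K: "(\<integral>\<^sup>+x. ennreal ((f K x - g x)\<^sup>2) \<partial>M) \<le> ennreal 1" by blast
  then have "(\<lambda>x. f K x - g x) \<in> L2 M"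
    unfolding L2_iff_nn_integral using le_less_trans by fastforce
  from L2_diff[OF f[of K] this] have g: "g \<in> L2 M" by simp
  have "(\<lambda>n. \<integral>x. (f n x - g x)\<^sup>2 \<partial>M) \<longlonglongrightarrow> 0"
  proof (rule LIMSEQ_I)
    fix e :: real assume "e > 0"
    then obtain K where K: "\<And>n. n \<ge> K \<Longrightarrow> (\<integral>\<^sup>+x. ennreal ((f n x - g x)\<^sup>2) \<partial>M) \<le> ennreal (e/2)"
      using bd[of "e/2"] by auto
    have "(\<integral>x. (f n x - g x)\<^sup>2 \<partial>M) < e" if "n \<ge> K" for n
      using K[OF that] nn_integral_square_L2[OF L2_diff[OF f g], of n] \<open>e > 0\<close>
      by (simp add: ennreal_le_iff)
    then show "\<exists>K. \<forall>n\<ge>K. norm ((\<integral>x. (f n x - g x)\<^sup>2 \<partial>M) - 0) < e"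
      by (auto intro!: exI[of _ K])
  qed
  with g that show ?thesis by blast
qed

text \<open>Both sides are suprema of finite partial sums; countability supplies the increasing
  sequence of finite sets for monotone convergence. Through this identity unordered sums can be
  interchanged as integrals.\<close>

lemma nn_integral_count_space_eq_infsum:
  fixes f :: "'i \<Rightarrow> ennreal"
  assumes "countable A"
  shows "(\<integral>\<^sup>+i. f i \<partial>count_space A) = infsum f A"
proof -
  have inf: "infsum f A = (SUP F\<in>{F. finite F \<and> F \<subseteq> A}. sum f F)"
    by (rule nonneg_infsum_complete) simp
  show ?thesis
  proof (rule antisym)
    \<comment> \<open>Intersecting with \<open>A\<close> matters when \<open>A\<close> is empty,
      where \<open>from_nat_into\<close> returns an arbitrary value.\<close>
    define B where "B n = from_nat_into A ` {..n} \<inter> A" for n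
    have B: "finite (B n)" "B n \<subseteq> A" for n unfolding B_def by auto
    have "(\<integral>\<^sup>+i. f i \<partial>count_space A) = (\<integral>\<^sup>+i. (SUP n. f i * indicator (B n) i) \<partial>count_space A)"
    proof (rule nn_integral_cong)
      fix i assume "i \<in> space (count_space A)"
      then have i: "i \<in> A" by simp
      obtain n where n: "from_nat_into A n = i"
        using from_nat_into_surj[OF assms i] by (elim exE)
      have "i \<in> B n" using i n unfolding B_def by auto
      then have "f i \<le> (SUP n. f i * indicator (B n) i)"
        by (intro SUP_upper2[of n]) auto
      moreover have "(SUP n. f i * indicator (B n) i) \<le> f i"
      proof (rule SUP_least)
        fix n show "f i * indicator (B n) i \<le> f i"
          by (cases "i \<in> B n") simp_all
      qed
      ultimately show "f i = (SUP n. f i * indicator (B n) i)" by (rule antisym)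
    qed
    also have "\<dots> = (SUP n. \<integral>\<^sup>+i. f i * indicator (B n) i \<partial>count_space A)"
    proof (intro nn_integral_monotone_convergence_SUP)
      show "incseq (\<lambda>n i. f i * indicator (B n) i)"
        unfolding incseq_def le_fun_def B_def
        by (intro allI impI mult_left_mono) (auto simp: indicator_def)
    qed simp
    also have "\<dots> \<le> infsum f A"
    proof (rule SUP_least)
      fix n
      have "(\<integral>\<^sup>+i. f i * indicator (B n) i \<partial>count_space A) = (\<Sum>i\<in>B n. f i * indicator (B n) i)"
        using B by (intro nn_integral_count_space') (auto split: split_indicator)
      also have "\<dots> = sum f (B n)" by simp
      also have "\<dots> \<le> infsum f A"
        unfolding inf using B by (intro SUP_upper) auto
      finally show "(\<integral>\<^sup>+i. f i * indicator (B n) i \<partial>count_space A) \<le> infsum f A" .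
    qed
    finally show "(\<integral>\<^sup>+i. f i \<partial>count_space A) \<le> infsum f A" .
    show "infsum f A \<le> (\<integral>\<^sup>+i. f i \<partial>count_space A)"
      unfolding inf
    proof (rule SUP_least, safe)
      fix F assume F: "finite F" "F \<subseteq> A"
      have "sum f F = (\<Sum>i\<in>F. f i * indicator F i)" by simp
      also have "\<dots> = (\<integral>\<^sup>+i. f i * indicator F i \<partial>count_space A)"
        using F by (intro nn_integral_count_space'[symmetric]) (auto split: split_indicator)
      also have "\<dots> \<le> (\<integral>\<^sup>+i. f i \<partial>count_space A)"
        by (intro nn_integral_mono) (simp add: indicator_def)
      finally show "sum f F \<le> (\<integral>\<^sup>+i. f i \<partial>count_space A)" .
    qed
  qed
qed

section \<open>Coordinate \<open>\<sigma>\<close>-algebras and resampling\<close>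

text \<open>If \<open>x\<close> and \<open>y\<close> are independent with law \<mu>, so is the
  splice distributed; integrating out \<open>y\<close> averages over the coordinates outside
  \<open>L\<close>, and the complement of \<open>{k}\<close> as \<open>L\<close> resamples
  coordinate \<open>k\<close>.\<close>

definition mix :: "nat set \<Rightarrow> (nat \<Rightarrow> 'a) \<Rightarrow> (nat \<Rightarrow> 'a) \<Rightarrow> nat \<Rightarrow> 'a" where
  "mix L x y = (\<lambda>i. if i \<in> L then x i else y i)"

text \<open>Only \<open>X\<close> is fixed here. The independent copy enters through explicit
  hypotheses of the lemmas on resampling.\<close>

locale product_sequence = prob_space P for P :: "'w measure" +
  fixes \<mu> :: "nat \<Rightarrow> 'a measure" and X :: "'w \<Rightarrow> nat \<Rightarrow> 'a"
  assumes prob_space_\<mu>: "\<And>n. prob_space (\<mu> n)"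
    and X_measurable [measurable]: "X \<in> P \<rightarrow>\<^sub>M PiM UNIV \<mu>"
    and distr_X: "distr P (PiM UNIV \<mu>) X = PiM UNIV \<mu>"
begin

abbreviation S :: "(nat \<Rightarrow> 'a) measure" where
  "S \<equiv> PiM UNIV \<mu>"

abbreviation \<F> :: "nat set \<Rightarrow> 'w measure" where
  "\<F> \<equiv> sigma_coords P \<mu> X"

abbreviation T :: "nat set \<Rightarrow> ('w \<Rightarrow> real) \<Rightarrow> 'w \<Rightarrow> real" where
  "T L \<equiv> real_cond_exp P (\<F> L)"

sublocale S: prob_space S
  by (rule prob_space_PiM) (rule prob_space_\<mu>)

sublocale SS: pair_sigma_finite S S
  by unfold_locales

section \<open>Coordinate \<sigma>-algebras and the probability space restricted to
  \<sigma>(X)\<close>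

lemma space_sigma_coords [simp]: "space (\<F> L) = space P"
  by (simp add: sigma_coords_def space_measure_of_conv)

lemma sets_sigma_coords:
  "sets (\<F> L) =
    sigma_sets (space P) (\<Union>j\<in>L. {(\<lambda>\<omega>. X \<omega> j) -` A \<inter> space P |A. A \<in> sets (\<mu> j)})"
  unfolding sigma_coords_def by (rule sets_measure_of) auto

lemma measurable_coordinate [measurable]: "(\<lambda>\<omega>. X \<omega> j) \<in> P \<rightarrow>\<^sub>M \<mu> j"
  by measurable

lemma X_in_space: "\<omega> \<in> space P \<Longrightarrow> X \<omega> \<in> space S"
  by (rule measurable_space[OF X_measurable])

lemma sigma_coords_subalgebra: "subalgebra P (\<F> L)"
  unfolding subalgebra_def sets_sigma_coords
  by (auto intro!: sets.sigma_sets_subset measurable_sets[OF measurable_coordinate])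

lemma sigma_coords_mono: "L \<subseteq> K \<Longrightarrow> sets (\<F> L) \<subseteq> sets (\<F> K)"
  unfolding sets_sigma_coords by (intro sigma_sets_mono') auto

lemma sigma_coords_subalgebra_mono: "L \<subseteq> K \<Longrightarrow> subalgebra (\<F> K) (\<F> L)"
  using sigma_coords_mono by (simp add: subalgebra_def)

lemma measurable_coordinate_sigma_coords: "j \<in> L \<Longrightarrow> (\<lambda>\<omega>. X \<omega> j) \<in> \<F> L \<rightarrow>\<^sub>M \<mu> j"
proof (rule measurableI)
  fix \<omega> assume "\<omega> \<in> space (\<F> L)"
  then show "X \<omega> j \<in> space (\<mu> j)"
    using measurable_space[OF measurable_coordinate] by simp
next
  fix A assume "j \<in> L" "A \<in> sets (\<mu> j)"
  then show "(\<lambda>\<omega>. X \<omega> j) -` A \<inter> space (\<F> L) \<in> sets (\<F> L)"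
    unfolding space_sigma_coords sets_sigma_coords by (intro sigma_sets.Basic) auto
qed

lemma sigma_coords_sigma_finite: "sigma_finite_subalgebra P (\<F> L)"
  by (intro finite_measure_subalgebra_is_sigma_finite finite_measure_subalgebra.intro
      finite_measure_subalgebra_axioms.intro finite_measure_axioms sigma_coords_subalgebra)

sublocale cond: sigma_finite_subalgebra P "\<F> L" for L
  by (rule sigma_coords_sigma_finite)

lemma measurable_sigma_coords: "f \<in> borel_measurable (\<F> L) \<Longrightarrow> f \<in> borel_measurable P"
  by (rule measurable_from_subalg[OF sigma_coords_subalgebra])

lemma measurable_sigma_coords_mono:
  "L \<subseteq> K \<Longrightarrow> f \<in> borel_measurable (\<F> L) \<Longrightarrow> f \<in> borel_measurable (\<F> K)"
  by (rule measurable_from_subalg[OF sigma_coords_subalgebra_mono])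

lemma measurable_X_sigma_coords: "X \<in> \<F> UNIV \<rightarrow>\<^sub>M S"
proof (rule measurable_PiM_single')
  show "(\<lambda>\<omega>. X \<omega> i) \<in> \<F> UNIV \<rightarrow>\<^sub>M \<mu> i" for i
    by (rule measurable_coordinate_sigma_coords) simp
  show "X \<in> space (\<F> UNIV) \<rightarrow> (\<Pi>\<^sub>E i\<in>UNIV. space (\<mu> i))"
    using X_in_space by (auto simp: space_PiM)
qed

text \<open>The product \<sigma>-algebra is generated by the coordinate maps, so pulling it back
  along \<open>X\<close> gives the \<sigma>-algebra of all coordinates. This brings
  \<open>P_X\<close> into the family \<open>\<F> L\<close>, with \<open>L = UNIV\<close>.\<close>

lemma sets_vimage_algebra_X: "sets (vimage_algebra (space P) X S) = sets (\<F> UNIV)"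
proof
  show "sets (vimage_algebra (space P) X S) \<subseteq> sets (\<F> UNIV)"
    by (rule sets_image_in_sets) (simp_all add: measurable_X_sigma_coords)
  have "(\<lambda>\<omega>. X \<omega> j) -` A \<inter> space P \<in> sets (vimage_algebra (space P) X S)"
    if A: "A \<in> sets (\<mu> j)" for j A
  proof -
    have "(\<lambda>\<omega>. X \<omega> j) -` A \<inter> space P = X -` ((\<lambda>x. x j) -` A \<inter> space S) \<inter> space P"
      using X_in_space by auto
    also have "\<dots> \<in> sets (vimage_algebra (space P) X S)"
      by (intro in_vimage_algebra measurable_sets[OF _ A]) measurable
    finally show ?thesis .
  qed
  then show "sets (\<F> UNIV) \<subseteq> sets (vimage_algebra (space P) X S)"
    unfolding sets_sigma_coords
    using sets.sigma_sets_subset[of "\<Union>j\<in>UNIV. {(\<lambda>\<omega>. X \<omega> j) -` A \<inter> space P |A. A \<in> sets (\<mu> j)}"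
        "vimage_algebra (space P) X S"]
    by (auto simp del: sets_vimage_algebra)
qed

lemma P_X_eq: "P_X P \<mu> X = restr_to_subalg P (\<F> UNIV)"
  unfolding P_X_def restr_to_subalg_def sets_vimage_algebra_X ..

lemma sets_P_X [measurable_cong]: "sets (P_X P \<mu> X) = sets (\<F> UNIV)"
  unfolding P_X_eq by (rule sets_restr_to_subalg[OF sigma_coords_subalgebra])

lemma prob_space_P_X: "prob_space (P_X P \<mu> X)"
  unfolding P_X_eq by (intro prob_space_restr_to_subalg sigma_coords_subalgebra prob_space_axioms)

lemma nn_integral_P_X:
  "f \<in> borel_measurable (\<F> UNIV) \<Longrightarrow> (\<integral>\<^sup>+\<omega>. f \<omega> \<partial>P_X P \<mu> X) = (\<integral>\<^sup>+\<omega>. f \<omega> \<partial>P)"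
  unfolding P_X_eq by (rule nn_integral_subalgebra2[OF sigma_coords_subalgebra])

text \<open>Restriction to a sub-\<sigma>-algebra preserves integrals of its measurable functions.
  Later computations can therefore use the single measure \<open>P\<close>, with
  \<open>\<F> UNIV\<close>-measurability as a side condition.\<close>

lemma L2_P_X_iff: "f \<in> L2 (P_X P \<mu> X) \<longleftrightarrow> f \<in> L2 P \<and> f \<in> borel_measurable (\<F> UNIV)"
proof -
  have "f \<in> borel_measurable (P_X P \<mu> X) \<longleftrightarrow> f \<in> borel_measurable (\<F> UNIV)"
    by (rule measurable_cong_sets[THEN eqset_imp_iff]) (simp_all add: sets_P_X)
  moreover have "(\<integral>\<^sup>+\<omega>. ennreal ((f \<omega>)\<^sup>2) \<partial>P_X P \<mu> X) = (\<integral>\<^sup>+\<omega>. ennreal ((f \<omega>)\<^sup>2) \<partial>P)"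
    if "f \<in> borel_measurable (\<F> UNIV)"
    using that by (intro nn_integral_P_X) measurable
  ultimately show ?thesis
    unfolding L2_iff_nn_integral using measurable_sigma_coords[of f UNIV] by metis
qed

lemma integral_X:
  fixes f :: "(nat \<Rightarrow> 'a) \<Rightarrow> real"
  assumes "f \<in> borel_measurable S"
  shows "(\<integral>\<omega>. f (X \<omega>) \<partial>P) = (\<integral>x. f x \<partial>S)"
  using integral_distr[OF X_measurable assms] by (simp add: distr_X)

lemma integrable_X_iff:
  fixes f :: "(nat \<Rightarrow> 'a) \<Rightarrow> real"
  assumes "f \<in> borel_measurable S"
  shows "integrable P (\<lambda>\<omega>. f (X \<omega>)) \<longleftrightarrow> integrable S f"
  using integrable_distr_eq[OF X_measurable assms] by (simp add: distr_X)

section \<open>Splicing two independent sequences, and conditional expectations as partial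
  integrals\<close>

lemma mix_in_space: "x \<in> space S \<Longrightarrow> y \<in> space S \<Longrightarrow> mix L x y \<in> space S"
  by (auto simp: space_PiM mix_def PiE_iff)

lemma measurable_mix [measurable (raw)]:
  assumes "f \<in> N \<rightarrow>\<^sub>M S" "g \<in> N \<rightarrow>\<^sub>M S"
  shows "(\<lambda>z. mix L (f z) (g z)) \<in> N \<rightarrow>\<^sub>M S"
proof (rule measurable_PiM_single')
  show "(\<lambda>z. mix L (f z) (g z) i) \<in> N \<rightarrow>\<^sub>M \<mu> i" for i
    unfolding mix_def using assms by (cases "i \<in> L") simp_all
  show "(\<lambda>z. mix L (f z) (g z)) \<in> space N \<rightarrow> (\<Pi>\<^sub>E i\<in>UNIV. space (\<mu> i))"
    using measurable_space[OF assms(1)] measurable_space[OF assms(2)]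
    by (auto simp: space_PiM mix_def PiE_iff)
qed

text \<open>The preimage of a cylinder over \<open>J\<close> is a rectangle that constrains the
  first sequence on \<open>J \<inter> L\<close> and the second on \<open>J - L\<close>. Its measure
  is the product of all factors, and cylinders determine the product measure.\<close>

lemma distr_mix: "distr (S \<Otimes>\<^sub>M S) S (\<lambda>z. mix L (fst z) (snd z)) = S"
proof -
  interpret \<mu>: prob_space "\<mu> i" for i by (rule prob_space_\<mu>)
  interpret prod: product_prob_space \<mu> UNIV by unfold_locales
  show ?thesis
  proof (rule prod.PiM_eq)
    fix J A assume J: "finite J" and A: "\<And>j. j \<in> J \<Longrightarrow> A j \<in> sets (\<mu> j)"
    let ?E = "\<lambda>J. prod_emb UNIV \<mu> J (\<Pi>\<^sub>E j\<in>J. A j)"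
    have E [measurable]: "?E K \<in> sets S" if "K \<subseteq> J" for K
      using that J A by (intro measurable_prod_emb sets_PiM_I_finite) (auto intro: finite_subset)
    have E_eq: "emeasure S (?E K) = (\<Prod>j\<in>K. emeasure (\<mu> j) (A j))" if "K \<subseteq> J" for K
      using that J A by (intro prod.emeasure_PiM_emb) (auto intro: finite_subset)
    have "(\<lambda>z. mix L (fst z) (snd z)) -` ?E J \<inter> space (S \<Otimes>\<^sub>M S) = ?E (J \<inter> L) \<times> ?E (J - L)"
      by (auto simp: prod_emb_def space_pair_measure space_PiM mix_def PiE_iff split: if_splits)
    then have "emeasure (distr (S \<Otimes>\<^sub>M S) S (\<lambda>z. mix L (fst z) (snd z))) (?E J) =
        emeasure (S \<Otimes>\<^sub>M S) (?E (J \<inter> L) \<times> ?E (J - L))"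
      by (subst emeasure_distr) (auto intro: E)
    also have "\<dots> = emeasure S (?E (J \<inter> L)) * emeasure S (?E (J - L))"
      by (intro S.emeasure_pair_measure_Times E) auto
    also have "\<dots> = (\<Prod>j\<in>J \<inter> L. emeasure (\<mu> j) (A j)) * (\<Prod>j\<in>J - L. emeasure (\<mu> j) (A j))"
      using E_eq[of "J \<inter> L"] E_eq[of "J - L"] by auto
    also have "\<dots> = (\<Prod>j\<in>J. emeasure (\<mu> j) (A j))"
      using J by (subst prod.Int_Diff[of J _ L]) auto
    finally show "emeasure (distr (S \<Otimes>\<^sub>M S) S (\<lambda>z. mix L (fst z) (snd z))) (?E J) =
        (\<Prod>j\<in>J. emeasure (\<mu> j) (A j))" .
  qed simp
qed

lemma measurable_case_mix [measurable]: "(\<lambda>z. mix L (fst z) (snd z)) \<in> S \<Otimes>\<^sub>M S \<rightarrow>\<^sub>M S"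
  by measurable

lemma integral_mix:
  fixes f :: "(nat \<Rightarrow> 'a) \<Rightarrow> real"
  assumes "f \<in> borel_measurable S"
  shows "(\<integral>z. f (mix L (fst z) (snd z)) \<partial>(S \<Otimes>\<^sub>M S)) = (\<integral>x. f x \<partial>S)"
  using integral_distr[OF measurable_case_mix assms, of L] by (simp add: distr_mix)

lemma integrable_mix:
  fixes f :: "(nat \<Rightarrow> 'a) \<Rightarrow> real"
  assumes "integrable S f"
  shows "integrable (S \<Otimes>\<^sub>M S) (\<lambda>z. f (mix L (fst z) (snd z)))"
  using integrable_distr[OF measurable_case_mix, of L f] assms by (simp add: distr_mix)

text \<open>The last property says that \<open>B\<close> does not see coordinates outside
  \<open>L\<close>. It holds for generators and survives complements and countable unions, hence the
  induction. It is what allows \<open>indicator B\<close> to be pulled out of an integral over fresh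
  coordinates.\<close>

lemma sets_sigma_coordsE:
  assumes "A \<in> sets (\<F> L)"
  obtains B where "B \<in> sets S" "A = X -` B \<inter> space P"
    "\<forall>x\<in>space S. \<forall>y\<in>space S. (\<forall>i\<in>L. x i = y i) \<longrightarrow> (x \<in> B \<longleftrightarrow> y \<in> B)"
proof -
  have "\<exists>B\<in>sets S. A = X -` B \<inter> space P \<and>
    (\<forall>x\<in>space S. \<forall>y\<in>space S. (\<forall>i\<in>L. x i = y i) \<longrightarrow> (x \<in> B \<longleftrightarrow> y \<in> B))"
    using assms unfolding sets_sigma_coords
  proof induction
    case (Basic A)
    then obtain j A' where j: "j \<in> L" "A' \<in> sets (\<mu> j)" "A = (\<lambda>\<omega>. X \<omega> j) -` A' \<inter> space P"
      by auto
    then show ?case using X_in_space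
      by (intro bexI[of _ "(\<lambda>x. x j) -` A' \<inter> space S"] measurable_sets[of _ _ "\<mu> j"]) auto
  next
    case Empty
    show ?case by (rule bexI[of _ "{}"]) auto
  next
    case (Compl A)
    then obtain B where B: "B \<in> sets S" "A = X -` B \<inter> space P"
      "\<forall>x\<in>space S. \<forall>y\<in>space S. (\<forall>i\<in>L. x i = y i) \<longrightarrow> (x \<in> B \<longleftrightarrow> y \<in> B)"
      by blast
    show ?case
    proof (intro bexI[of _ "space S - B"] conjI ballI impI)
      show "space P - A = X -` (space S - B) \<inter> space P"
        using X_in_space B(2) by auto
      fix x y assume "x \<in> space S" "y \<in> space S" "\<forall>i\<in>L. x i = y i"
      then show "x \<in> space S - B \<longleftrightarrow> y \<in> space S - B" using B(3) by blast
    qed (use B(1) in simp)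
  next
    case (Union A)
    define Q where "Q i B \<longleftrightarrow> B \<in> sets S \<and> A i = X -` B \<inter> space P \<and>
      (\<forall>x\<in>space S. \<forall>y\<in>space S. (\<forall>j\<in>L. x j = y j) \<longrightarrow> (x \<in> B \<longleftrightarrow> y \<in> B))" for i B
    have "\<forall>i. \<exists>B. Q i B" using Union.IH unfolding Q_def Bex_def by (rule allI)
    then obtain B where "\<forall>i. Q i (B i)" by (rule choice[elim_format]) (elim exE)
    then have "Q i (B i)" for i by (rule spec)
    note Q = this[unfolded Q_def]
    note B = Q[THEN conjunct1] Q[THEN conjunct2, THEN conjunct1] Q[THEN conjunct2, THEN conjunct2]
    show ?case
    proof (intro bexI[of _ "\<Union>i. B i"] conjI ballI impI)
      fix x y assume xy: "x \<in> space S" "y \<in> space S" "\<forall>i\<in>L. x i = y i"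
      have "x \<in> B i \<longleftrightarrow> y \<in> B i" for i
        by (rule bspec[OF bspec[OF B(3)[of i] xy(1)] xy(2), THEN mp, OF xy(3)])
      then show "x \<in> (\<Union>i. B i) \<longleftrightarrow> y \<in> (\<Union>i. B i)" by simp
    next
      show "(\<Union>i. A i) = X -` (\<Union>i. B i) \<inter> space P"
        unfolding B(2) vimage_UN by blast
      show "(\<Union>i. B i) \<in> sets S"
        using B(1) by (intro sets.countable_UN) auto
    qed
  qed
  then obtain B where B: "B \<in> sets S" "A = X -` B \<inter> space P"
    "\<forall>x\<in>space S. \<forall>y\<in>space S. (\<forall>i\<in>L. x i = y i) \<longrightarrow> (x \<in> B \<longleftrightarrow> y \<in> B)"
    by (elim bexE conjE)
  show ?thesis
    by (rule that[OF B])
qed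

lemma cond_exp_mix:
  fixes f :: "(nat \<Rightarrow> 'a) \<Rightarrow> real"
  assumes f: "integrable S f"
  shows "AE \<omega> in P. T L (\<lambda>\<omega>. f (X \<omega>)) \<omega> = (\<integral>y. f (mix L (X \<omega>) y) \<partial>S)"
proof (rule cond.real_cond_exp_charact)
  have [measurable]: "f \<in> borel_measurable S" using f by simp
  define g where "g x = (\<integral>y. f (mix L x y) \<partial>S)" for x
  have gS [measurable]: "g \<in> borel_measurable S" unfolding g_def by measurable
  have g: "integrable S g"
    unfolding g_def using SS.integrable_fst'[OF integrable_mix[OF f, of L]] by simp
  show "integrable P (\<lambda>\<omega>. f (X \<omega>))" using f by (simp add: integrable_X_iff)
  show "integrable P (\<lambda>\<omega>. \<integral>y. f (mix L (X \<omega>) y) \<partial>S)"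
    using g unfolding g_def[symmetric] by (simp add: integrable_X_iff)
  show "(\<lambda>\<omega>. \<integral>y. f (mix L (X \<omega>) y) \<partial>S) \<in> borel_measurable (\<F> L)"
  proof (rule S.borel_measurable_lebesgue_integral)
    \<comment> \<open>Splicing reads only those coordinates of \<open>X\<close> that lie in
      \<open>L\<close>, which makes it measurable already for \<open>\<F> L\<close>.\<close>
    have "(\<lambda>z. mix L (X (fst z)) (snd z)) \<in> \<F> L \<Otimes>\<^sub>M S \<rightarrow>\<^sub>M S"
    proof (rule measurable_PiM_single')
      show "(\<lambda>z. mix L (X (fst z)) (snd z) i) \<in> \<F> L \<Otimes>\<^sub>M S \<rightarrow>\<^sub>M \<mu> i" for i
        unfolding mix_def
        using measurable_compose[OF measurable_fst measurable_coordinate_sigma_coords[of i L], of S]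
        by (cases "i \<in> L") simp_all
      show "(\<lambda>z. mix L (X (fst z)) (snd z)) \<in> space (\<F> L \<Otimes>\<^sub>M S) \<rightarrow> (\<Pi>\<^sub>E i\<in>UNIV. space (\<mu> i))"
        using X_in_space by (auto simp: space_pair_measure space_PiM mix_def PiE_iff)
    qed
    from measurable_compose[OF this \<open>f \<in> borel_measurable S\<close>]
    show "(\<lambda>(\<omega>, y). f (mix L (X \<omega>) y)) \<in> borel_measurable (\<F> L \<Otimes>\<^sub>M S)"
      by (simp add: case_prod_beta')
  qed
  fix A assume "A \<in> sets (\<F> L)"
  then obtain B where B [measurable]: "B \<in> sets S" and A: "A = X -` B \<inter> space P"
    and inv': "\<forall>x\<in>space S. \<forall>y\<in>space S. (\<forall>i\<in>L. x i = y i) \<longrightarrow> (x \<in> B \<longleftrightarrow> y \<in> B)"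
    by (rule sets_sigma_coordsE)
  note inv = inv'[rule_format]
  have to_S: "(\<integral>\<omega>\<in>A. h (X \<omega>) \<partial>P) = (\<integral>x. indicator B x * h x \<partial>S)"
    if [measurable]: "h \<in> borel_measurable S" for h :: "(nat \<Rightarrow> 'a) \<Rightarrow> real"
  proof -
    have "(\<integral>\<omega>\<in>A. h (X \<omega>) \<partial>P) = (\<integral>\<omega>. indicator B (X \<omega>) * h (X \<omega>) \<partial>P)"
      unfolding set_lebesgue_integral_def A
      by (intro Bochner_Integration.integral_cong) (auto split: split_indicator)
    also have "\<dots> = (\<integral>x. indicator B x * h x \<partial>S)"
      by (rule integral_X) measurable
    finally show ?thesis .
  qed
  have Bf: "integrable S (\<lambda>x. indicator B x * f x)"
    using f by (intro integrable_mult_indicator[where 'b=real, simplified]) auto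
  \<comment> \<open>The spliced point has the same law as \<open>x\<close>, so the integral may be
    evaluated there before \<open>y\<close> is separated off.\<close>
  have "(\<integral>x. indicator B x * f x \<partial>S) = (\<integral>x. \<integral>y. indicator B (mix L x y) * f (mix L x y) \<partial>S \<partial>S)"
    using SS.integral_fst'[OF integrable_mix[OF Bf, of L]] integral_mix[of "\<lambda>x. indicator B x * f x" L]
    by simp
  also have "\<dots> = (\<integral>x. indicator B x * g x \<partial>S)"
  proof (rule Bochner_Integration.integral_cong[OF refl])
    fix x assume x: "x \<in> space S"
    have "(\<integral>y. indicator B (mix L x y) * f (mix L x y) \<partial>S) = (\<integral>y. indicator B x * f (mix L x y) \<partial>S)"
    proof (rule Bochner_Integration.integral_cong[OF refl])
      fix y assume "y \<in> space S"
      then have "mix L x y \<in> B \<longleftrightarrow> x \<in> B"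
        using x by (intro inv mix_in_space) (auto simp: mix_def)
      then show "indicator B (mix L x y) * f (mix L x y) = indicator B x * f (mix L x y)"
        by (simp add: indicator_def)
    qed
    then show "(\<integral>y. indicator B (mix L x y) * f (mix L x y) \<partial>S) = indicator B x * g x"
      by (simp add: g_def)
  qed
  finally show "(\<integral>\<omega>\<in>A. f (X \<omega>) \<partial>P) = (\<integral>\<omega>\<in>A. (\<integral>y. f (mix L (X \<omega>) y) \<partial>S) \<partial>P)"
    using to_S[of f] to_S[OF gS] unfolding g_def by simp
qed

text \<open>On the coordinates in \<open>L\<close>, splicing along \<open>K\<close> and along
  \<open>K \<inter> L\<close> gives the same point, and the set behind \<open>A\<close> looks at no
  others. This is where independence enters the composition rule for projections.\<close>

lemma cond_exp_indicator_Int: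
  assumes A: "A \<in> sets (\<F> L)"
  shows "AE \<omega> in P. T K (indicator A) \<omega> = T (K \<inter> L) (indicator A) \<omega>"
proof -
  obtain B where B [measurable]: "B \<in> sets S" and AB: "A = X -` B \<inter> space P"
    and inv': "\<forall>x\<in>space S. \<forall>y\<in>space S. (\<forall>i\<in>L. x i = y i) \<longrightarrow> (x \<in> B \<longleftrightarrow> y \<in> B)"
    using A by (rule sets_sigma_coordsE)
  note inv = inv'[rule_format]
  have [measurable]: "A \<in> sets P" using A sigma_coords_subalgebra[of L] by (auto simp: subalgebra_def)
  have eq: "AE \<omega> in P. T M (indicator A) \<omega> = (\<integral>y. indicator B (mix M (X \<omega>) y) \<partial>S)" for M
  proof -
    have "AE \<omega> in P. T M (indicator A) \<omega> = T M (\<lambda>\<omega>. indicator B (X \<omega>)) \<omega>"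
      by (intro cond.real_cond_exp_cong AE_I2) (auto simp: AB split: split_indicator)
    moreover have "integrable S (indicator B :: _ \<Rightarrow> real)"
      by (simp add: S.emeasure_eq_measure)
    note cond_exp_mix[OF this, of M]
    ultimately show ?thesis by eventually_elim simp
  qed
  have key: "(\<integral>y. indicator B (mix K (X \<omega>) y) \<partial>S) = (\<integral>y. indicator B (mix (K \<inter> L) (X \<omega>) y) \<partial>S :: real)"
    if \<omega>: "\<omega> \<in> space P" for \<omega>
  proof (rule Bochner_Integration.integral_cong[OF refl])
    fix y assume "y \<in> space S"
    then have "mix K (X \<omega>) y \<in> B \<longleftrightarrow> mix (K \<inter> L) (X \<omega>) y \<in> B"
      using X_in_space[OF \<omega>] by (intro inv mix_in_space) (auto simp: mix_def)
    then show "indicator B (mix K (X \<omega>) y) = (indicator B (mix (K \<inter> L) (X \<omega>) y) :: real)"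
      by (simp add: indicator_def)
  qed
  from eq[of K] eq[of "K \<inter> L"] AE_space show ?thesis
    by eventually_elim (simp add: key)
qed

end

section \<open>Conditional expectations and Hoeffding components\<close>

text \<open>The subsets of \<open>M\<close> are paired as \<open>L\<close> and
  \<open>insert k L\<close>: the signs are opposite, while the intersections with \<open>N\<close>
  agree.\<close>

lemma alternating_sum_Pow_eq_0:
  fixes g :: "'b set \<Rightarrow> real"
  assumes "finite M" "k \<in> M" "k \<notin> N"
  shows "(\<Sum>L\<in>Pow M. (-1) ^ (card M - card L) * g (L \<inter> N)) = 0"
proof -
  define M' where "M' = M - {k}"
  have M: "M = insert k M'" "k \<notin> M'" "finite M'"
    using assms by (auto simp: M'_def)
  let ?t = "\<lambda>L. (-1) ^ (card M - card L) * g (L \<inter> N)"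
  have "sum ?t (Pow M) = sum ?t (Pow M') + sum ?t (insert k ` Pow M')"
    unfolding M(1) Pow_insert using M by (intro sum.union_disjoint) auto
  also have "sum ?t (insert k ` Pow M') = (\<Sum>L\<in>Pow M'. ?t (insert k L))"
    using M(2) by (subst sum.reindex) (auto simp: inj_on_def o_def insert_ident)
  also have "\<dots> = (\<Sum>L\<in>Pow M'. - ?t L)"
  proof (rule sum.cong[OF refl])
    fix L assume "L \<in> Pow M'"
    then have L: "L \<subseteq> M'" "k \<notin> L" "finite L" using M finite_subset by auto
    have "card M - card L = Suc (card M - card (insert k L))"
      using L M card_mono[OF M(3) L(1)] by simp
    moreover have "insert k L \<inter> N = L \<inter> N" using assms by auto
    ultimately show "?t (insert k L) = - ?t L" by simp
  qed
  finally show ?thesis by (simp add: sum_negf)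
qed

text \<open>Moebius inversion on finite subsets. The symmetric inclusion-exclusion formula carries
  the sign of \<open>card L\<close> alone, so both sides are first multiplied by
  \<open>(-1) ^ card M\<close>.\<close>

lemma sum_Pow_mobius:
  fixes q :: "'b set \<Rightarrow> real"
  assumes "finite N"
  shows "(\<Sum>M\<in>Pow N. \<Sum>L\<in>Pow M. (-1) ^ (card M - card L) * q L) = q N"
proof -
  define c where "c M = (\<Sum>L\<in>Pow M. (-1) ^ (card M - card L) * q L)" for M
  have sign: "(-1) ^ card M * (-1) ^ (card M - card L) = (-1::real) ^ card L"
    if "finite M" "L \<in> Pow M" for L M :: "'b set"
  proof -
    have "card L \<le> card M" using that by (simp add: card_mono)
    then have "card M + (card M - card L) = 2 * (card M - card L) + card L" by simp
    then have "(-1::real) ^ (card M + (card M - card L)) = (-1) ^ card L"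
      by (simp only: power_add power_mult) simp
    then show ?thesis by (simp add: power_add)
  qed
  have "(-1) ^ card M * c M = (\<Sum>L\<in>Pow M. (-1) ^ card L * q L)" if "finite M" for M
    unfolding c_def sum_distrib_left using sign[OF that]
    by (intro sum.cong refl) (simp flip: mult.assoc)
  from inclusion_exclusion_symmetric[of "\<lambda>M. (-1) ^ card M * c M" q, OF this assms]
  have "q N = (\<Sum>T\<in>Pow N. (-1) ^ card T * ((-1) ^ card T * c T))" .
  also have "\<dots> = (\<Sum>T\<in>Pow N. c T)"
    by simp
  finally show ?thesis by (simp add: c_def)
qed

text \<open>A finite family of finite sets lies below some bound. Limits along the net of finite
  subfamilies can thus be evaluated along a sequence.\<close>

lemma filterlim_sets_below:
  assumes A: "A \<subseteq> {M. finite M}"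
  shows "filterlim (\<lambda>n::nat. {M \<in> A. M \<subseteq> {..<n}}) (finite_subsets_at_top A) sequentially"
  unfolding filterlim_finite_subsets_at_top
proof safe
  fix Y assume Y: "finite Y" "Y \<subseteq> A"
  then have "finite (\<Union>Y)" using A by auto
  then obtain k where k: "\<Union>Y \<subseteq> {..<k}" using finite_nat_iff_bounded by auto
  have "\<forall>\<^sub>F n in sequentially. n \<ge> k" by (rule eventually_ge_at_top)
  then show "\<forall>\<^sub>F n in sequentially. finite {M \<in> A. M \<subseteq> {..<n}} \<and>
      Y \<subseteq> {M \<in> A. M \<subseteq> {..<n}} \<and> {M \<in> A. M \<subseteq> {..<n}} \<subseteq> A"
  proof eventually_elim
    case (elim n)
    have "M \<subseteq> {..<n}" if "M \<in> Y" for M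
      using k elim that by fastforce
    then show ?case
      using Y by (auto intro: finite_subset[of _ "Pow {..<n}"])
  qed
qed

lemma (in prob_space) expectation_square_le:
  assumes "f \<in> L2 M"
  shows "(expectation f)\<^sup>2 \<le> expectation (\<lambda>x. (f x)\<^sup>2)"
proof -
  note f = L2_D[OF assms]
  show ?thesis
    using variance_positive[of f] variance_eq[OF square_integrable_imp_integrable[OF f] f(2)] by linarith
qed

lemma integral_square_nonneg: "0 \<le> (\<integral>x. (f x :: real)\<^sup>2 \<partial>M)"
  by simp

context product_sequence
begin

section \<open>Conditional expectations as a commuting family of orthogonal projections\<close>

lemma L2_integrable: "f \<in> L2 P \<Longrightarrow> integrable P f"
  by (rule square_integrable_imp_integrable) (rule L2_D, assumption)+

text \<open>Conditional Jensen for the square function on the whole line; the two zeros fill the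
  slots for interval endpoints.\<close>

lemma L2_T:
  assumes "f \<in> L2 P"
  shows "T L f \<in> L2 P"
proof -
  have "integrable P (\<lambda>\<omega>. (T L f \<omega>)\<^sup>2)"
    by (rule cond.integrable_convex_cond_exp[of f UNIV 0 0 "\<lambda>x. x\<^sup>2" L])
      (use assms in \<open>simp_all add: L2_integrable L2_D convex_power2\<close>)
  then show ?thesis by (simp add: L2_def)
qed

lemma L2_indicator: "A \<in> sets P \<Longrightarrow> indicator A \<in> L2 P"
  by (auto simp: L2_def power2_eq_square emeasure_eq_measure simp flip: indicator_inter_arith)

text \<open>In other words, \<open>f - T L f\<close> is orthogonal to such \<open>g\<close>. Used
  twice, this makes \<open>T L\<close> self-adjoint.\<close>

lemma integral_mult_T:
  assumes "f \<in> L2 P" "g \<in> L2 P" "g \<in> borel_measurable (\<F> L)"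
  shows "(\<integral>\<omega>. g \<omega> * T L f \<omega> \<partial>P) = (\<integral>\<omega>. g \<omega> * f \<omega> \<partial>P)"
  by (rule cond.real_cond_exp_intg(2)[OF L2_mult_integrable[OF assms(2,1)] assms(3)])
    (rule L2_D(1)[OF assms(1)])

text \<open>Tested against \<open>A\<close> in \<open>\<F> L\<close>, both sides become integrals of
  \<open>f\<close> against a projected indicator of \<open>A\<close>, and these projected indicators
  coincide. In this way \<open>f\<close> itself may be any element of L^2 and is never written as a
  function of \<open>X\<close>.\<close>

lemma T_T:
  assumes f: "f \<in> L2 P"
  shows "AE \<omega> in P. T L (T K f) \<omega> = T (K \<inter> L) f \<omega>"
proof (rule cond.real_cond_exp_charact)
  show "integrable P (T K f)" "integrable P (T (K \<inter> L) f)"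
    by (intro L2_integrable L2_T f)+
  show "T (K \<inter> L) f \<in> borel_measurable (\<F> L)"
    by (rule measurable_sigma_coords_mono[OF _ borel_measurable_cond_exp]) simp
  fix A assume A: "A \<in> sets (\<F> L)"
  then have AP: "A \<in> sets P" using sigma_coords_subalgebra[of L] by (auto simp: subalgebra_def)
  note ind = L2_indicator[OF AP]
  \<comment> \<open>Self-adjointness of \<open>T M\<close>, passing through the symmetric expression
    with both factors projected.\<close>
  have *: "(\<integral>\<omega>\<in>A. T M f \<omega> \<partial>P) = (\<integral>\<omega>. T M (indicator A) \<omega> * f \<omega> \<partial>P)" for M
  proof -
    have "(\<integral>\<omega>\<in>A. T M f \<omega> \<partial>P) = (\<integral>\<omega>. T M f \<omega> * indicator A \<omega> \<partial>P)"
      by (simp add: set_lebesgue_integral_def mult.commute)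
    also have "\<dots> = (\<integral>\<omega>. T M f \<omega> * T M (indicator A) \<omega> \<partial>P)"
      by (intro integral_mult_T[symmetric] ind L2_T f) simp
    also have "\<dots> = (\<integral>\<omega>. T M (indicator A) \<omega> * T M f \<omega> \<partial>P)"
      by (simp add: mult.commute)
    also have "\<dots> = (\<integral>\<omega>. T M (indicator A) \<omega> * f \<omega> \<partial>P)"
      by (intro integral_mult_T ind L2_T f) simp
    finally show ?thesis .
  qed
  have [measurable]: "f \<in> borel_measurable P" using L2_D[OF f] by simp
  show "(\<integral>\<omega>\<in>A. T K f \<omega> \<partial>P) = (\<integral>\<omega>\<in>A. T (K \<inter> L) f \<omega> \<partial>P)"
    unfolding *
    by (rule Bochner_Integration.integral_cong_AE)
      (use cond_exp_indicator_Int[OF A, of K] in \<open>auto elim: eventually_mono\<close>)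
qed

definition energy :: "('w \<Rightarrow> real) \<Rightarrow> nat set \<Rightarrow> real" where
  "energy f L = (\<integral>\<omega>. (T L f \<omega>)\<^sup>2 \<partial>P)"

text \<open>The Gram matrix of the projections: self-adjointness and the composition rule, applied
  once from each side, reduce both factors to the projection onto
  \<open>K \<inter> L\<close>.\<close>

lemma integral_T_T:
  assumes f: "f \<in> L2 P"
  shows "(\<integral>\<omega>. T K f \<omega> * T L f \<omega> \<partial>P) = energy f (K \<inter> L)"
proof -
  have [measurable]: "f \<in> borel_measurable P" using L2_D[OF f] by simp
  have "(\<integral>\<omega>. T K f \<omega> * T L f \<omega> \<partial>P) = (\<integral>\<omega>. T K f \<omega> * T K (T L f) \<omega> \<partial>P)"
    by (intro integral_mult_T[symmetric] L2_T f) simp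
  also have "\<dots> = (\<integral>\<omega>. T K f \<omega> * T (K \<inter> L) f \<omega> \<partial>P)"
    by (rule Bochner_Integration.integral_cong_AE)
      (use T_T[OF f, of K L] in \<open>auto elim: eventually_mono simp: Int_commute\<close>)
  also have "\<dots> = (\<integral>\<omega>. T (K \<inter> L) f \<omega> * T K f \<omega> \<partial>P)"
    by (simp add: mult.commute)
  also have "\<dots> = (\<integral>\<omega>. T (K \<inter> L) f \<omega> * T (K \<inter> L) (T K f) \<omega> \<partial>P)"
    by (intro integral_mult_T[symmetric] L2_T f) simp
  also have "\<dots> = (\<integral>\<omega>. T (K \<inter> L) f \<omega> * T (K \<inter> L) f \<omega> \<partial>P)"
    by (rule Bochner_Integration.integral_cong_AE)
      (use T_T[OF f, of "K \<inter> L" K] in \<open>auto elim: eventually_mono simp: Int_assoc[symmetric]\<close>)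
  finally show ?thesis by (simp add: energy_def power2_eq_square)
qed

text \<open>Pythagoras: since \<open>K \<inter> L = L\<close>, the cross term is the smaller
  energy.\<close>

lemma integral_T_diff_square:
  assumes f: "f \<in> L2 P" and "L \<subseteq> K"
  shows "(\<integral>\<omega>. (T K f \<omega> - T L f \<omega>)\<^sup>2 \<partial>P) = energy f K - energy f L"
proof -
  have KL: "K \<inter> L = L" using assms by auto
  note i = L2_D(2)[OF L2_T[OF f]] L2_mult_integrable[OF L2_T[OF f] L2_T[OF f]]
  have "(\<integral>\<omega>. (T K f \<omega> - T L f \<omega>)\<^sup>2 \<partial>P) =
      (\<integral>\<omega>. (T K f \<omega>)\<^sup>2 - 2 * (T K f \<omega> * T L f \<omega>) + (T L f \<omega>)\<^sup>2 \<partial>P)"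
    by (simp add: power2_diff algebra_simps)
  also have "\<dots> = energy f K - 2 * (\<integral>\<omega>. T K f \<omega> * T L f \<omega> \<partial>P) + energy f L"
    using i by (simp add: energy_def)
  finally show ?thesis by (simp add: integral_T_T[OF f] KL)
qed

lemma energy_mono: "f \<in> L2 P \<Longrightarrow> L \<subseteq> K \<Longrightarrow> energy f L \<le> energy f K"
  using integral_T_diff_square[of f L K] integral_square_nonneg[of P "\<lambda>\<omega>. T K f \<omega> - T L f \<omega>"]
  by linarith

lemma energy_nonneg: "0 \<le> energy f L"
  by (simp add: energy_def)

lemma L2_X_iff: "f \<in> L2_X P \<mu> X \<longleftrightarrow> f \<in> L2 P \<and> f \<in> borel_measurable (\<F> UNIV)"
  unfolding L2_X_def by (rule L2_P_X_iff)

lemma L2_X_L2: "f \<in> L2_X P \<mu> X \<Longrightarrow> f \<in> L2 P"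
  by (simp add: L2_X_iff)

lemma L2_X_T: "f \<in> L2 P \<Longrightarrow> T L f \<in> L2_X P \<mu> X"
  unfolding L2_X_iff using measurable_sigma_coords_mono[OF subset_UNIV borel_measurable_cond_exp]
  by (auto intro: L2_T)

lemma L2_X_diff: "f \<in> L2_X P \<mu> X \<Longrightarrow> g \<in> L2_X P \<mu> X \<Longrightarrow> (\<lambda>\<omega>. f \<omega> - g \<omega>) \<in> L2_X P \<mu> X"
  unfolding L2_X_def by (rule L2_diff)

lemma T_UNIV: "f \<in> L2_X P \<mu> X \<Longrightarrow> AE \<omega> in P. T UNIV f \<omega> = f \<omega>"
  by (intro cond.real_cond_exp_F_meas L2_integrable) (auto simp: L2_X_iff)

lemma integral_P_X:
  fixes f :: "'w \<Rightarrow> real"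
  shows "f \<in> borel_measurable (\<F> UNIV) \<Longrightarrow> (\<integral>\<omega>. f \<omega> \<partial>P_X P \<mu> X) = (\<integral>\<omega>. f \<omega> \<partial>P)"
  unfolding P_X_eq by (rule integral_subalgebra2[OF sigma_coords_subalgebra])

lemma energy_UNIV:
  assumes f: "f \<in> L2_X P \<mu> X"
  shows "energy f UNIV = (\<integral>\<omega>. (f \<omega>)\<^sup>2 \<partial>P)"
proof -
  have [measurable]: "f \<in> borel_measurable P" using L2_D[OF L2_X_L2[OF f]] by simp
  show ?thesis unfolding energy_def
    by (rule Bochner_Integration.integral_cong_AE)
      (use T_UNIV[OF f] in \<open>auto elim: eventually_mono\<close>)
qed

lemma integral_diff_T_square:
  assumes f: "f \<in> L2_X P \<mu> X"
  shows "(\<integral>\<omega>. (f \<omega> - T L f \<omega>)\<^sup>2 \<partial>P) = energy f UNIV - energy f L"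
proof -
  have [measurable]: "f \<in> borel_measurable P" using L2_D[OF L2_X_L2[OF f]] by simp
  have "(\<integral>\<omega>. (f \<omega> - T L f \<omega>)\<^sup>2 \<partial>P) = (\<integral>\<omega>. (T UNIV f \<omega> - T L f \<omega>)\<^sup>2 \<partial>P)"
    by (rule Bochner_Integration.integral_cong_AE)
      (use T_UNIV[OF f] in \<open>auto elim: eventually_mono\<close>)
  then show ?thesis by (simp add: integral_T_diff_square L2_X_L2[OF f])
qed

section \<open>Approximation by finitely many coordinates\<close>

lemma sets_sigma_coords_UNIV: "sets (\<F> UNIV) = sigma_sets (space P) (\<Union>n. sets (\<F> {..<n::nat}))"
proof
  show "sets (\<F> UNIV) \<subseteq> sigma_sets (space P) (\<Union>n. sets (\<F> {..<n::nat}))"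
    unfolding sets_sigma_coords[of UNIV]
  proof (rule sigma_sets_mono, safe)
    fix j A assume "A \<in> sets (\<mu> j)"
    then have "(\<lambda>\<omega>. X \<omega> j) -` A \<inter> space P \<in> sets (\<F> {..<Suc j})"
      using measurable_sets[OF measurable_coordinate_sigma_coords[of j "{..<Suc j}"]] by auto
    then show "(\<lambda>\<omega>. X \<omega> j) -` A \<inter> space P \<in> sigma_sets (space P) (\<Union>n. sets (\<F> {..<n::nat}))"
      by (intro sigma_sets.Basic) auto
  qed
  show "sigma_sets (space P) (\<Union>n. sets (\<F> {..<n::nat})) \<subseteq> sets (\<F> UNIV)"
    using sets.sigma_sets_subset[of "\<Union>n. sets (\<F> {..<n::nat})" "\<F> UNIV"] sigma_coords_mono[OF subset_UNIV]
    by auto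
qed

text \<open>The limit exists by completeness; it is \<open>f\<close> because both have the same integrals over the
  generating \<open>\<pi>\<close>-system of cylinder events.\<close>

lemma energy_lessThan_tendsto_UNIV:
  assumes f: "f \<in> L2_X P \<mu> X"
  shows "(\<lambda>n. energy f {..<n}) \<longlonglongrightarrow> energy f UNIV"
proof -
  note fP = L2_X_L2[OF f]
  have TL2: "T {..<n} f \<in> L2 (P_X P \<mu> X)" for n :: nat
    using L2_X_T[OF fP] by (simp add: L2_X_def)
  have diffX: "(\<integral>\<omega>. (g \<omega> - h \<omega>)\<^sup>2 \<partial>P_X P \<mu> X) = (\<integral>\<omega>. (g \<omega> - h \<omega>)\<^sup>2 \<partial>P)"
    if "g \<in> L2 (P_X P \<mu> X)" "h \<in> L2 (P_X P \<mu> X)" for g h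
    using that by (intro integral_P_X) (auto simp: L2_P_X_iff)
  \<comment> \<open>Energies are monotone and bounded; by Pythagoras their Cauchy property is that
    of the projections in L^2.\<close>
  have "convergent (\<lambda>n. energy f {..<n})"
  proof (rule Bseq_mono_convergent)
    show "Bseq (\<lambda>n. energy f {..<n})"
      using energy_mono[OF fP subset_UNIV] energy_nonneg by (intro BseqI'[of _ "energy f UNIV"]) auto
    show "\<forall>m n. m \<le> n \<longrightarrow> energy f {..<m} \<le> energy f {..<n}"
      by (auto intro!: energy_mono fP)
  qed
  then have C: "Cauchy (\<lambda>n. energy f {..<n})" by (rule convergent_Cauchy)
  obtain g where g: "g \<in> L2 (P_X P \<mu> X)"
    and lim: "(\<lambda>n. \<integral>\<omega>. (T {..<n} f \<omega> - g \<omega>)\<^sup>2 \<partial>P_X P \<mu> X) \<longlonglongrightarrow> 0"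
  proof (rule L2_complete[OF TL2])
    fix e :: real assume "e > 0"
    with C obtain N where N: "\<And>m n. m \<ge> N \<Longrightarrow> n \<ge> N \<Longrightarrow> \<bar>energy f {..<m} - energy f {..<n}\<bar> < e"
      unfolding Cauchy_def dist_real_def by blast
    have dist: "(\<integral>\<omega>. (T {..<m} f \<omega> - T {..<n} f \<omega>)\<^sup>2 \<partial>P) < e" if "m \<ge> N" "n \<ge> N" "n \<le> m" for m n
      using N[OF that(1,2)] that(3) by (subst integral_T_diff_square[OF fP]) auto
    have "(\<integral>\<omega>. (T {..<m} f \<omega> - T {..<n} f \<omega>)\<^sup>2 \<partial>P_X P \<mu> X) < e" if "m \<ge> N" "n \<ge> N" for m n
      unfolding diffX[OF TL2 TL2]
    proof (cases "n \<le> m")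
      case True then show "(\<integral>\<omega>. (T {..<m} f \<omega> - T {..<n} f \<omega>)\<^sup>2 \<partial>P) < e" using dist that by simp
    next
      case False then show "(\<integral>\<omega>. (T {..<m} f \<omega> - T {..<n} f \<omega>)\<^sup>2 \<partial>P) < e"
        using dist[of n m] that by (simp add: power2_commute)
    qed
    then show "\<exists>N. \<forall>m\<ge>N. \<forall>n\<ge>N. (\<integral>\<omega>. (T {..<m} f \<omega> - T {..<n} f \<omega>)\<^sup>2 \<partial>P_X P \<mu> X) < e"
      by blast
  qed
  have gP: "g \<in> L2 P" "g \<in> borel_measurable (\<F> UNIV)" using g by (auto simp: L2_P_X_iff)
  have lim: "(\<lambda>n. \<integral>\<omega>. (T {..<n} f \<omega> - g \<omega>)\<^sup>2 \<partial>P) \<longlonglongrightarrow> 0"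
    using lim by (simp add: diffX[OF TL2 g])
  have fi: "integrable P f" and gi: "integrable P g" by (intro L2_integrable fP gP)+
  have sP: "A \<in> sets P" if "A \<in> sets (\<F> L)" for A L
    using that sigma_coords_subalgebra[of L] by (auto simp: subalgebra_def)
  define h where "h \<omega> = f \<omega> - g \<omega>" for \<omega>
  have hi: "set_integrable P A h" if "A \<in> sets P" for A
    unfolding set_integrable_def h_def
    by (intro integrable_mult_indicator that Bochner_Integration.integrable_diff fi gi)
  have zero: "(\<integral>\<omega>\<in>A. h \<omega> \<partial>P) = 0" if "A \<in> sets (\<F> UNIV)" for A
  proof -
    \<comment> \<open>For \<open>n \<ge> m\<close> the event also lies in
      \<open>\<F> {..<n}\<close>, so \<open>f\<close> may be replaced by its projection; the squared
      integral is then at most the squared distance of that projection to \<open>g\<close>, which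
      tends to 0.\<close>
    have cyl: "(\<integral>\<omega>\<in>A. h \<omega> \<partial>P) = 0" if A: "A \<in> sets (\<F> {..<m::nat})" for A m
    proof -
      have AP [measurable]: "A \<in> sets P" using A by (rule sP)
      have "(\<integral>\<omega>\<in>A. h \<omega> \<partial>P)\<^sup>2 \<le> (\<integral>\<omega>. (T {..<n} f \<omega> - g \<omega>)\<^sup>2 \<partial>P)" if "n \<ge> m" for n
      proof -
        have "A \<in> sets (\<F> {..<n})" using sigma_coords_mono[of "{..<m}" "{..<n}"] A that by auto
        then have "(\<integral>\<omega>\<in>A. f \<omega> \<partial>P) = (\<integral>\<omega>\<in>A. T {..<n} f \<omega> \<partial>P)"
          by (intro cond.real_cond_exp_intA fi)
        moreover have ii: "set_integrable P A u" if "integrable P u" for u :: "'w \<Rightarrow> real"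
          unfolding set_integrable_def using that by (intro integrable_mult_indicator AP)
        ultimately have "(\<integral>\<omega>\<in>A. h \<omega> \<partial>P) = (\<integral>\<omega>\<in>A. T {..<n} f \<omega> - g \<omega> \<partial>P)"
          unfolding h_def using fi gi L2_integrable[OF L2_T[OF fP]]
          by (simp add: set_integral_diff ii)
        also have "\<dots> = expectation (\<lambda>\<omega>. indicator A \<omega> * (T {..<n} f \<omega> - g \<omega>))"
          by (simp add: set_lebesgue_integral_def)
        finally have eq: "(\<integral>\<omega>\<in>A. h \<omega> \<partial>P) = expectation (\<lambda>\<omega>. indicator A \<omega> * (T {..<n} f \<omega> - g \<omega>))" .
        have d: "(\<lambda>\<omega>. T {..<n} f \<omega> - g \<omega>) \<in> L2 P" by (intro L2_diff L2_T fP gP)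
        have id: "(\<lambda>\<omega>. indicator A \<omega> * (T {..<n} f \<omega> - g \<omega>)) \<in> L2 P"
        proof -
          have "(\<lambda>\<omega>. (indicator A \<omega> * (T {..<n} f \<omega> - g \<omega>))\<^sup>2) =
              (\<lambda>\<omega>. indicator A \<omega> *\<^sub>R (T {..<n} f \<omega> - g \<omega>)\<^sup>2)"
            by (auto simp: indicator_def)
          then show ?thesis
            using L2_D[OF d] integrable_mult_indicator[OF AP L2_D(2)[OF d]] by (simp add: L2_def)
        qed
        have "(\<integral>\<omega>\<in>A. h \<omega> \<partial>P)\<^sup>2 \<le> expectation (\<lambda>\<omega>. (indicator A \<omega> * (T {..<n} f \<omega> - g \<omega>))\<^sup>2)"
          unfolding eq by (rule expectation_square_le[OF id])
        also have "\<dots> \<le> expectation (\<lambda>\<omega>. (T {..<n} f \<omega> - g \<omega>)\<^sup>2)"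
          using L2_D[OF d] L2_D[OF id]
          by (intro integral_mono) (auto simp: power_mult_distrib split: split_indicator)
        finally show ?thesis .
      qed
      then have "(\<integral>\<omega>\<in>A. h \<omega> \<partial>P)\<^sup>2 \<le> 0"
        by (intro LIMSEQ_le_const[OF lim]) auto
      then show ?thesis by simp
    qed
    have A: "A \<in> sigma_sets (space P) (\<Union>n. sets (\<F> {..<n::nat}))"
      using that sets_sigma_coords_UNIV by simp
    have "Int_stable (\<Union>n. sets (\<F> {..<n::nat}))"
    proof (rule Int_stableI)
      fix A B assume "A \<in> (\<Union>n. sets (\<F> {..<n::nat}))" "B \<in> (\<Union>n. sets (\<F> {..<n::nat}))"
      then obtain m n where "A \<in> sets (\<F> {..<m::nat})" "B \<in> sets (\<F> {..<n::nat})" by auto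
      then have "A \<in> sets (\<F> {..<max m n})" "B \<in> sets (\<F> {..<max m n})"
        using sigma_coords_mono[of "{..<m}" "{..<max m n}"] sigma_coords_mono[of "{..<n}" "{..<max m n}"]
        by auto
      then show "A \<inter> B \<in> (\<Union>n. sets (\<F> {..<n::nat}))" by blast
    qed
    moreover have "(\<Union>n. sets (\<F> {..<n::nat})) \<subseteq> Pow (space P)"
      using sets.space_closed by fastforce
    ultimately show ?thesis using A
    proof (induction rule: sigma_sets_induct_disjoint)
      case (basic A) then show ?case using cyl by auto
    next
      case empty show ?case by (simp add: set_lebesgue_integral_def)
    next
      case (compl A)
      then have A: "A \<in> sets P" using sets_sigma_coords_UNIV sP[of A UNIV] by simp
      \<comment> \<open>The whole space is itself a cylinder event, depending on no coordinate,
        which is what the complement step requires.\<close>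
      have "space P \<in> sets (\<F> {..<0})" using sets.top[of "\<F> {..<0}"] by simp
      from cyl[OF this] have "(\<integral>\<omega>\<in>space P. h \<omega> \<partial>P) = 0" .
      moreover have "(\<integral>\<omega>\<in>space P. h \<omega> \<partial>P) = (\<integral>\<omega>\<in>(space P - A) \<union> A. h \<omega> \<partial>P)"
        using sets.sets_into_space[OF A] by (simp add: Un_absorb2)
      moreover have "\<dots> = (\<integral>\<omega>\<in>space P - A. h \<omega> \<partial>P) + (\<integral>\<omega>\<in>A. h \<omega> \<partial>P)"
        using A by (intro set_integral_Un hi) auto
      ultimately show ?case using compl by simp
    next
      case (union A)
      then have A: "A i \<in> sets P" for i using sets_sigma_coords_UNIV sP[of "A i" UNIV] by auto
      have "(\<integral>\<omega>\<in>(\<Union>i. A i). h \<omega> \<partial>P) = (\<Sum>i. \<integral>\<omega>\<in>A i. h \<omega> \<partial>P)"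
        using A union(1) by (intro lebesgue_integral_countable_add hi)
          (auto simp: disjoint_family_on_def)
      then show ?case using union by simp
    qed
  qed
  have "(\<integral>\<omega>\<in>A. f \<omega> \<partial>P) = (\<integral>\<omega>\<in>A. g \<omega> \<partial>P)" if "A \<in> sets (\<F> UNIV)" for A
  proof -
    have "set_integrable P A f" "set_integrable P A g"
      unfolding set_integrable_def by (intro integrable_mult_indicator sP[OF that] fi gi)+
    from set_integral_diff(2)[OF this] show ?thesis using zero[OF that] by (simp add: h_def)
  qed
  then have "AE \<omega> in P. T UNIV f \<omega> = g \<omega>"
    by (intro cond.real_cond_exp_charact fi gi gP)
  then have fg: "AE \<omega> in P. f \<omega> = g \<omega>" using T_UNIV[OF f] by eventually_elim simp
  have [measurable]: "f \<in> borel_measurable P" "g \<in> borel_measurable P" using fi gi by auto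
  have "(\<integral>\<omega>. (T {..<n} f \<omega> - g \<omega>)\<^sup>2 \<partial>P) = energy f UNIV - energy f {..<n}" for n
    unfolding integral_diff_T_square[OF f, symmetric]
    by (rule Bochner_Integration.integral_cong_AE)
      (use fg in \<open>auto elim!: eventually_mono simp: power2_commute\<close>)
  with lim have "(\<lambda>n. energy f UNIV - (energy f UNIV - energy f {..<n})) \<longlonglongrightarrow> energy f UNIV - 0"
    by (intro tendsto_intros) simp
  then show ?thesis by simp
qed

lemma energy_le: "f \<in> L2_X P \<mu> X \<Longrightarrow> energy f L \<le> (\<integral>\<omega>. (f \<omega>)\<^sup>2 \<partial>P)"
  using energy_mono[OF L2_X_L2 subset_UNIV, of f L] energy_UNIV[of f] by simp

lemma T_diff:
  assumes "f \<in> L2 P" "g \<in> L2 P"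
  shows "AE \<omega> in P. T L (\<lambda>\<omega>. f \<omega> - g \<omega>) \<omega> = T L f \<omega> - T L g \<omega>"
  by (intro cond.real_cond_exp_diff L2_integrable assms)

text \<open>\<open>T L\<close> maps the remainder to \<open>T L f - T (K \<inter> L) f\<close>, so
  Pythagoras applies. The formula yields both uniform tail bounds and the derivatives of truncation
  errors.\<close>

lemma energy_diff_T:
  assumes f: "f \<in> L2 P"
  shows "energy (\<lambda>\<omega>. f \<omega> - T K f \<omega>) L = energy f L - energy f (K \<inter> L)"
proof -
  have [measurable]: "f \<in> borel_measurable P" using L2_D[OF f] by simp
  have "AE \<omega> in P. T L (\<lambda>\<omega>. f \<omega> - T K f \<omega>) \<omega> = T L f \<omega> - T (K \<inter> L) f \<omega>"
    using T_diff[OF f L2_T[OF f], of L K] T_T[OF f, of L K] by eventually_elim simp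
  then have "energy (\<lambda>\<omega>. f \<omega> - T K f \<omega>) L = (\<integral>\<omega>. (T L f \<omega> - T (K \<inter> L) f \<omega>)\<^sup>2 \<partial>P)"
    unfolding energy_def by (intro Bochner_Integration.integral_cong_AE) (auto elim: eventually_mono)
  then show ?thesis by (simp add: integral_T_diff_square[OF f])
qed

text \<open>The gap is the energy at \<open>N\<close> of the remainder after truncation, hence at
  most its full squared norm. Convergence for \<open>UNIV\<close> therefore carries over to every
  \<open>N\<close>.\<close>

lemma energy_Int_lessThan_tendsto:
  assumes f: "f \<in> L2_X P \<mu> X"
  shows "(\<lambda>n. energy f (N \<inter> {..<n})) \<longlonglongrightarrow> energy f N"
proof -
  note fP = L2_X_L2[OF f]
  have bound: "energy f N - energy f (N \<inter> {..<n}) \<le> energy f UNIV - energy f {..<n}" for n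
  proof -
    have "energy f N - energy f ({..<n} \<inter> N) = energy (\<lambda>\<omega>. f \<omega> - T {..<n} f \<omega>) N"
      by (rule energy_diff_T[OF fP, symmetric])
    also have "\<dots> \<le> (\<integral>\<omega>. (f \<omega> - T {..<n} f \<omega>)\<^sup>2 \<partial>P)"
      by (intro energy_le L2_X_diff L2_X_T f fP)
    finally show ?thesis by (simp add: integral_diff_T_square[OF f] Int_commute)
  qed
  have "(\<lambda>n. energy f N - energy f (N \<inter> {..<n})) \<longlonglongrightarrow> 0"
  proof (rule tendsto_sandwich[OF _ _ tendsto_const])
    show "\<forall>\<^sub>F n in sequentially. 0 \<le> energy f N - energy f (N \<inter> {..<n})"
      by (simp add: energy_mono[OF fP])
    show "\<forall>\<^sub>F n in sequentially. energy f N - energy f (N \<inter> {..<n}) \<le> energy f UNIV - energy f {..<n}"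
      using bound by simp
    show "(\<lambda>n. energy f UNIV - energy f {..<n}) \<longlonglongrightarrow> 0"
      using tendsto_diff[OF tendsto_const energy_lessThan_tendsto_UNIV[OF f], of "energy f UNIV"] by simp
  qed
  from tendsto_diff[OF tendsto_const this, of "energy f N"] show ?thesis by simp
qed

text \<open>The value of \<open>E[F\<^sub>M\<^sup>2]\<close>, see \<open>component_energy_eq\<close> below.\<close>

definition component_energy :: "('w \<Rightarrow> real) \<Rightarrow> nat set \<Rightarrow> real" where
  "component_energy f M = (\<Sum>L\<in>Pow M. (-1) ^ (card M - card L) * energy f L)"

section \<open>Orthogonality of the Hoeffding components\<close>

abbreviation H :: "('w \<Rightarrow> real) \<Rightarrow> nat set \<Rightarrow> 'w \<Rightarrow> real" where
  "H \<equiv> Hoeffding_component P \<mu> X"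

lemma L2_X_Hoeffding: "f \<in> L2 P \<Longrightarrow> H f M \<in> L2_X P \<mu> X"
  using L2_X_T[of f] unfolding Hoeffding_component_def L2_X_def
  by (intro L2_sum L2_cmult)

lemma integral_Hoeffding_mult:
  assumes f: "f \<in> L2 P" and g: "g \<in> L2 P"
  shows "(\<integral>\<omega>. H f M \<omega> * g \<omega> \<partial>P) =
    (\<Sum>L\<in>Pow M. (-1) ^ (card M - card L) * (\<integral>\<omega>. T L f \<omega> * g \<omega> \<partial>P))"
proof -
  have "(\<integral>\<omega>. H f M \<omega> * g \<omega> \<partial>P) =
      (\<integral>\<omega>. (\<Sum>L\<in>Pow M. (-1) ^ (card M - card L) * (T L f \<omega> * g \<omega>)) \<partial>P)"
    by (simp add: Hoeffding_component_def sum_distrib_right mult.assoc)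
  also have "\<dots> = (\<Sum>L\<in>Pow M. \<integral>\<omega>. (-1) ^ (card M - card L) * (T L f \<omega> * g \<omega>) \<partial>P)"
    by (intro Bochner_Integration.integral_sum integrable_mult_right L2_mult_integrable L2_T f g)
  finally show ?thesis by simp
qed

text \<open>Expanding the component replaces each \<open>energy f L\<close> in the alternating sum
  by \<open>energy f (L \<inter> N)\<close>. An element of \<open>M\<close> outside \<open>N\<close>
  makes the terms cancel in pairs; otherwise the intersection changes nothing.\<close>

lemma integral_Hoeffding_T:
  assumes f: "f \<in> L2 P" and M: "finite M"
  shows "(\<integral>\<omega>. H f M \<omega> * T N f \<omega> \<partial>P) = (if M \<subseteq> N then component_energy f M else 0)"
proof -
  let ?s = "\<Sum>L\<in>Pow M. (-1) ^ (card M - card L) * energy f (L \<inter> N)"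
  have "(\<integral>\<omega>. H f M \<omega> * T N f \<omega> \<partial>P) = ?s"
    by (simp add: integral_Hoeffding_mult f L2_T integral_T_T)
  moreover have "?s = 0" if "\<not> M \<subseteq> N"
    using that M by (auto intro: alternating_sum_Pow_eq_0)
  moreover have "?s = component_energy f M" if "M \<subseteq> N"
    unfolding component_energy_def
  proof (rule sum.cong[OF refl])
    fix L assume "L \<in> Pow M"
    with that have "L \<inter> N = L" by auto
    then show "(-1) ^ (card M - card L) * energy f (L \<inter> N) = (-1) ^ (card M - card L) * energy f L"
      by simp
  qed
  ultimately show ?thesis by simp
qed

text \<open>Expanding one factor over \<open>L \<subseteq> N\<close> leaves only terms with
  \<open>M \<subseteq> L\<close>. If \<open>M = N\<close>, just \<open>L = M\<close> survives, with
  sign +1; if they differ, one of them is not contained in the other and is taken as the factor left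
  unexpanded.\<close>

lemma integral_Hoeffding_Hoeffding:
  assumes f: "f \<in> L2 P" and M: "finite M" and N: "finite N"
  shows "(\<integral>\<omega>. H f M \<omega> * H f N \<omega> \<partial>P) = (if M = N then component_energy f M else 0)"
proof -
  have *: "(\<integral>\<omega>. H f N \<omega> * H f M \<omega> \<partial>P) =
      (\<Sum>L\<in>Pow N. (-1) ^ (card N - card L) * (if M \<subseteq> L then component_energy f M else 0))"
    if "finite M" "finite N" for M N
  proof -
    have "(\<integral>\<omega>. T L f \<omega> * H f M \<omega> \<partial>P) = (if M \<subseteq> L then component_energy f M else 0)" for L
      using integral_Hoeffding_T[OF f that(1), of L] by (simp add: mult.commute)
    then show ?thesis
      using integral_Hoeffding_mult[OF f L2_X_L2[OF L2_X_Hoeffding[OF f]], of N M] by simp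
  qed
  have zero: "(\<integral>\<omega>. H f N \<omega> * H f M \<omega> \<partial>P) = 0" if "finite M" "finite N" "\<not> M \<subseteq> N" for M N
    unfolding *[OF that(1,2)] using that(3) by (intro sum.neutral) auto
  consider "M = N" | "\<not> M \<subseteq> N" | "\<not> N \<subseteq> M" by auto
  then show ?thesis
  proof cases
    case 1
    have "(\<integral>\<omega>. H f M \<omega> * H f M \<omega> \<partial>P) = (\<Sum>L\<in>Pow M. if L = M then component_energy f M else 0)"
      unfolding *[OF M M] by (intro sum.cong) auto
    also have "\<dots> = component_energy f M" using M by simp
    finally show ?thesis using 1 by simp
  next
    case 2
    then show ?thesis using zero[OF M N] by (auto simp: mult.commute)
  next
    case 3
    then show ?thesis using zero[OF N M] by auto
  qed
qed

lemma component_energy_eq: "f \<in> L2 P \<Longrightarrow> finite M \<Longrightarrow> (\<integral>\<omega>. (H f M \<omega>)\<^sup>2 \<partial>P) = component_energy f M"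
  using integral_Hoeffding_Hoeffding[of f M M] by (simp add: power2_eq_square)

lemma component_energy_nonneg: "f \<in> L2 P \<Longrightarrow> finite M \<Longrightarrow> 0 \<le> component_energy f M"
  by (simp flip: component_energy_eq)

lemma sum_component_energy: "finite N \<Longrightarrow> (\<Sum>M\<in>Pow N. component_energy f M) = energy f N"
  unfolding component_energy_def by (rule sum_Pow_mobius)

lemma integral_sum_Hoeffding_square:
  assumes f: "f \<in> L2 P" and A: "finite A" "\<And>M. M \<in> A \<Longrightarrow> finite M"
  shows "(\<integral>\<omega>. (\<Sum>M\<in>A. H f M \<omega>)\<^sup>2 \<partial>P) = (\<Sum>M\<in>A. component_energy f M)"
proof -
  note HL2 = L2_X_L2[OF L2_X_Hoeffding[OF f]]
  have "(\<integral>\<omega>. (\<Sum>M\<in>A. H f M \<omega>)\<^sup>2 \<partial>P) = (\<integral>\<omega>. (\<Sum>M\<in>A. \<Sum>N\<in>A. H f M \<omega> * H f N \<omega>) \<partial>P)"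
    by (simp add: power2_eq_square sum_product)
  also have "\<dots> = (\<Sum>M\<in>A. \<integral>\<omega>. (\<Sum>N\<in>A. H f M \<omega> * H f N \<omega>) \<partial>P)"
    by (intro Bochner_Integration.integral_sum Bochner_Integration.integrable_sum L2_mult_integrable HL2)
  also have "\<dots> = (\<Sum>M\<in>A. \<Sum>N\<in>A. \<integral>\<omega>. H f M \<omega> * H f N \<omega> \<partial>P)"
    by (intro sum.cong refl Bochner_Integration.integral_sum L2_mult_integrable HL2)
  also have "\<dots> = (\<Sum>M\<in>A. \<Sum>N\<in>A. if N = M then component_energy f M else 0)"
    using A(2) by (intro sum.cong refl) (auto simp: integral_Hoeffding_Hoeffding[OF f])
  also have "\<dots> = (\<Sum>M\<in>A. component_energy f M)" using A by simp
  finally show ?thesis .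
qed

text \<open>Finite partial sums are bounded by the energy of the union of their index sets, so the
  series converges. Its value is read off along the subsets of \<open>N \<inter> {..<n}\<close>,
  where Moebius inversion is available even if \<open>N\<close> is infinite.\<close>

lemma has_sum_component_energy:
  assumes f: "f \<in> L2_X P \<mu> X"
  shows "(component_energy f has_sum energy f N) {M. finite M \<and> M \<subseteq> N}"
proof -
  note fP = L2_X_L2[OF f]
  let ?A = "{M. finite M \<and> M \<subseteq> N}"
  have "sum (component_energy f) Y \<le> energy f N" if Y: "finite Y" "Y \<subseteq> ?A" for Y
  proof -
    have fin: "finite (\<Union>Y)" using Y by auto
    have "sum (component_energy f) Y \<le> sum (component_energy f) (Pow (\<Union>Y))"
      using fin Y by (intro sum_mono2) (auto intro!: component_energy_nonneg[OF fP] intro: finite_subset)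
    also have "\<dots> = energy f (\<Union>Y)" using fin by (rule sum_component_energy)
    also have "\<dots> \<le> energy f N" using Y by (intro energy_mono fP) auto
    finally show ?thesis .
  qed
  then have "component_energy f summable_on ?A"
    by (intro nonneg_bounded_partial_sums_imp_summable_on[where C="energy f N"]
        eventually_finite_subsets_at_top_weakI) (auto intro: component_energy_nonneg[OF fP])
  then have hs: "(component_energy f has_sum infsum (component_energy f) ?A) ?A" by simp
  moreover have "filterlim (\<lambda>n. Pow (N \<inter> {..<n})) (finite_subsets_at_top ?A) sequentially"
  proof -
    have "Pow (N \<inter> {..<n}) = {M \<in> ?A. M \<subseteq> {..<n}}" for n :: nat
      by (auto intro: finite_subset)
    then show ?thesis using filterlim_sets_below[of ?A] by auto
  qed
  ultimately have "(\<lambda>n. sum (component_energy f) (Pow (N \<inter> {..<n}))) \<longlonglongrightarrow> infsum (component_energy f) ?A"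
    unfolding has_sum_def by (rule filterlim_compose)
  moreover have "sum (component_energy f) (Pow (N \<inter> {..<n})) = energy f (N \<inter> {..<n})" for n by (rule sum_component_energy) simp
  ultimately have "(\<lambda>n. energy f (N \<inter> {..<n})) \<longlonglongrightarrow> infsum (component_energy f) ?A" by (simp only:)
  with energy_Int_lessThan_tendsto[OF f, of N] have "infsum (component_energy f) ?A = energy f N"
    using LIMSEQ_unique by blast
  with hs show ?thesis by simp
qed

end

section \<open>The Malliavin derivative\<close>

lemma L2_Cauchy_Schwarz:
  assumes u: "u \<in> L2 M" and v: "v \<in> L2 M"
  shows "\<bar>\<integral>x. u x * v x \<partial>M\<bar> \<le> sqrt ((\<integral>x. (u x)\<^sup>2 \<partial>M) * (\<integral>x. (v x)\<^sup>2 \<partial>M))"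
proof -
  let ?I = "\<integral>x. \<bar>u x * v x\<bar> \<partial>M"
  have [measurable]: "u \<in> borel_measurable M" "v \<in> borel_measurable M"
    using L2_D[OF u] L2_D[OF v] by auto
  have "ennreal (?I\<^sup>2) = (\<integral>\<^sup>+x. ennreal \<bar>u x\<bar> * ennreal \<bar>v x\<bar> \<partial>M)\<^sup>2"
    using nn_integral_eq_integral[OF integrable_abs[OF L2_mult_integrable[OF u v]]]
    by (simp add: abs_mult flip: ennreal_mult ennreal_power)
  also have "\<dots> \<le> (\<integral>\<^sup>+x. (ennreal \<bar>u x\<bar>)\<^sup>2 \<partial>M) * (\<integral>\<^sup>+x. (ennreal \<bar>v x\<bar>)\<^sup>2 \<partial>M)"
    by (rule Cauchy_Schwarz_nn_integral) measurable
  also have "\<dots> = ennreal ((\<integral>x. (u x)\<^sup>2 \<partial>M) * (\<integral>x. (v x)\<^sup>2 \<partial>M))"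
    by (simp add: ennreal_power nn_integral_square_L2[OF u] nn_integral_square_L2[OF v] ennreal_mult)
  finally have "?I\<^sup>2 \<le> (\<integral>x. (u x)\<^sup>2 \<partial>M) * (\<integral>x. (v x)\<^sup>2 \<partial>M)"
    by (subst (asm) ennreal_le_iff) simp_all
  then have "?I \<le> sqrt ((\<integral>x. (u x)\<^sup>2 \<partial>M) * (\<integral>x. (v x)\<^sup>2 \<partial>M))"
    by (rule real_le_rsqrt)
  then show ?thesis using integral_abs_bound[of M "\<lambda>x. u x * v x"] by linarith
qed

text \<open>With \<open>a = (a - b) + b\<close> the cross term vanishes in the limit by
  Cauchy-Schwarz. The filter is arbitrary because unconditional sums converge along a net.\<close>

lemma L2_norm_tendsto:
  assumes a: "\<And>i. a i \<in> L2 M" and b: "b \<in> L2 M"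
    and lim: "((\<lambda>i. \<integral>x. (a i x - b x)\<^sup>2 \<partial>M) \<longlongrightarrow> 0) \<Phi>"
  shows "((\<lambda>i. \<integral>x. (a i x)\<^sup>2 \<partial>M) \<longlongrightarrow> (\<integral>x. (b x)\<^sup>2 \<partial>M)) \<Phi>"
proof -
  let ?d = "\<lambda>i. \<integral>x. (a i x - b x)\<^sup>2 \<partial>M" and ?e = "\<lambda>i. \<integral>x. (a i x - b x) * b x \<partial>M"
  have d: "(\<lambda>x. a i x - b x) \<in> L2 M" for i by (intro L2_diff a b)
  have "((\<lambda>i. sqrt (?d i * (\<integral>x. (b x)\<^sup>2 \<partial>M))) \<longlongrightarrow> sqrt (0 * (\<integral>x. (b x)\<^sup>2 \<partial>M))) \<Phi>"
    by (intro tendsto_intros lim)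
  then have "((\<lambda>i. sqrt (?d i * (\<integral>x. (b x)\<^sup>2 \<partial>M))) \<longlongrightarrow> 0) \<Phi>" by simp
  then have e: "(?e \<longlongrightarrow> 0) \<Phi>"
    by (rule Lim_null_comparison[rotated])
      (use L2_Cauchy_Schwarz[OF d b] in \<open>auto intro!: always_eventually\<close>)
  have "(\<integral>x. (a i x)\<^sup>2 \<partial>M) = ?d i + 2 * ?e i + (\<integral>x. (b x)\<^sup>2 \<partial>M)" for i
  proof -
    have "(\<integral>x. (a i x)\<^sup>2 \<partial>M) = (\<integral>x. (a i x - b x)\<^sup>2 + 2 * ((a i x - b x) * b x) + (b x)\<^sup>2 \<partial>M)"
      by (intro Bochner_Integration.integral_cong) (auto simp: power2_eq_square algebra_simps)
    then show ?thesis
      using L2_D[OF d[of i]] L2_mult_integrable[OF d[of i] b] L2_D[OF b] by simp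
  qed
  moreover have "((\<lambda>i. ?d i + 2 * ?e i + (\<integral>x. (b x)\<^sup>2 \<partial>M)) \<longlongrightarrow> 0 + 2 * 0 + (\<integral>x. (b x)\<^sup>2 \<partial>M)) \<Phi>"
    by (intro tendsto_intros lim e)
  ultimately show ?thesis by simp
qed

lemma L2_dist_sq_commute: "L2_dist_sq M f g = L2_dist_sq M g f"
  unfolding L2_dist_sq_def by (simp add: power2_commute)

lemma infsum_ennreal_eq:
  assumes "(f has_sum s) A" "\<And>x. x \<in> A \<Longrightarrow> 0 \<le> f x"
  shows "(\<Sum>\<^sub>\<infinity>x\<in>A. ennreal (f x)) = ennreal s"
proof (rule infsumI)
  have "((\<lambda>Y. ennreal (sum f Y)) \<longlongrightarrow> ennreal s) (finite_subsets_at_top A)"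
    using assms(1) unfolding has_sum_def by (rule tendsto_ennrealI)
  moreover have "\<forall>\<^sub>F Y in finite_subsets_at_top A. ennreal (sum f Y) = (\<Sum>x\<in>Y. ennreal (f x))"
    by (rule eventually_finite_subsets_at_top_weakI) (use assms(2) in \<open>auto simp: sum_ennreal subset_eq\<close>)
  ultimately show "((\<lambda>x. ennreal (f x)) has_sum ennreal s) A"
    unfolding has_sum_def by (rule Lim_transform_eventually)
qed

text \<open>The Doob-Dynkin factorization, by induction over the construction of nonnegative
  measurable functions.\<close>

lemma borel_measurable_vimage_algebra_factor_ennreal:
  fixes u :: "'b \<Rightarrow> ennreal"
  assumes "X \<in> \<Omega> \<rightarrow> space M" and "u \<in> borel_measurable (vimage_algebra \<Omega> X M)"
  shows "\<exists>f\<in>borel_measurable M. \<forall>\<omega>\<in>\<Omega>. u \<omega> = f (X \<omega>)"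
  using assms(2)
proof (induction rule: borel_measurable_induct)
  case (cong f g)
  then show ?case by simp
next
  case (set A)
  then obtain B where "B \<in> sets M" "A = X -` B \<inter> \<Omega>"
    using sets_vimage_algebra2[OF assms(1)] by auto
  then show ?case
    by (intro bexI[of _ "indicator B"]) (auto simp: indicator_def)
next
  case (mult u r)
  from mult.IH obtain f where "f \<in> borel_measurable M" "\<forall>\<omega>\<in>\<Omega>. u \<omega> = f (X \<omega>)"
    by (elim bexE)
  then show ?case by (intro bexI[of _ "\<lambda>x. r * f x"]) simp_all
next
  case (add u v)
  from add.IH obtain f g where "f \<in> borel_measurable M" "\<forall>\<omega>\<in>\<Omega>. u \<omega> = f (X \<omega>)"
    "g \<in> borel_measurable M" "\<forall>\<omega>\<in>\<Omega>. v \<omega> = g (X \<omega>)"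
    by (elim bexE)
  then show ?case by (intro bexI[of _ "\<lambda>x. g x + f x"]) simp_all
next
  case (seq U)
  from seq.IH have "\<forall>i. \<exists>f. f \<in> borel_measurable M \<and> (\<forall>\<omega>\<in>\<Omega>. U i \<omega> = f (X \<omega>))"
    by (simp add: Bex_def)
  from choice[OF this] obtain f
    where f: "\<forall>i. f i \<in> borel_measurable M \<and> (\<forall>\<omega>\<in>\<Omega>. U i \<omega> = f i (X \<omega>))" ..
  show ?case
  \<comment> \<open>The factors may fail to increase off the range of \<open>X\<close>; a supremum,
    unlike a limit, exists there as well.\<close>
  proof (intro bexI[of _ "\<lambda>x. SUP i. f i x"] ballI)
    fix \<omega> assume "\<omega> \<in> \<Omega>"
    have "(SUP i. U i) \<omega> = (SUP i. U i \<omega>)" by (rule SUP_apply)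
    also have "\<dots> = (SUP i. f i (X \<omega>))"
      using f \<open>\<omega> \<in> \<Omega>\<close> by (intro SUP_cong) simp_all
    finally show "(SUP i. U i) \<omega> = (SUP i. f i (X \<omega>))" .
  qed (use f in \<open>intro borel_measurable_SUP, auto\<close>)
qed

lemma borel_measurable_vimage_algebra_factor:
  fixes u :: "'b \<Rightarrow> real"
  assumes X: "X \<in> \<Omega> \<rightarrow> space M" and u: "u \<in> borel_measurable (vimage_algebra \<Omega> X M)"
  obtains f where "f \<in> borel_measurable M" "\<And>\<omega>. \<omega> \<in> \<Omega> \<Longrightarrow> u \<omega> = f (X \<omega>)"
proof -
  \<comment> \<open>Since \<open>ennreal\<close> sends negative reals to 0, these are the positive
    and the negative part of \<open>u\<close>.\<close>
  have "(\<lambda>\<omega>. ennreal (u \<omega>)) \<in> borel_measurable (vimage_algebra \<Omega> X M)"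
    "(\<lambda>\<omega>. ennreal (- u \<omega>)) \<in> borel_measurable (vimage_algebra \<Omega> X M)"
    using u by measurable
  from this[THEN borel_measurable_vimage_algebra_factor_ennreal[OF X]]
  obtain f g where fg: "f \<in> borel_measurable M" "g \<in> borel_measurable M"
    "\<And>\<omega>. \<omega> \<in> \<Omega> \<Longrightarrow> ennreal (u \<omega>) = f (X \<omega>)" "\<And>\<omega>. \<omega> \<in> \<Omega> \<Longrightarrow> ennreal (- u \<omega>) = g (X \<omega>)"
    by auto
  show ?thesis
  proof (rule that)
    show "(\<lambda>x. enn2real (f x) - enn2real (g x)) \<in> borel_measurable M" using fg by measurable
    show "u \<omega> = enn2real (f (X \<omega>)) - enn2real (g (X \<omega>))" if "\<omega> \<in> \<Omega>" for \<omega>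
      unfolding fg(3,4)[OF that, symmetric]
      by (cases "u \<omega> \<ge> 0") (simp_all add: ennreal_neg)
  qed
qed

context product_sequence
begin

section \<open>The derivative as an element of the L^2-space over the product with counting
  measure\<close>

abbreviation D :: "nat \<Rightarrow> ('w \<Rightarrow> real) \<Rightarrow> 'w \<Rightarrow> real" where
  "D \<equiv> Dk P \<mu> X"

definition derivative_energy :: "('w \<Rightarrow> real) \<Rightarrow> nat \<Rightarrow> real" where
  "derivative_energy f k = energy f UNIV - energy f (UNIV - {k})"

lemma L2_X_D: "f \<in> L2_X P \<mu> X \<Longrightarrow> D k f \<in> L2_X P \<mu> X"
  unfolding Dk_def by (intro L2_X_diff L2_X_T L2_X_L2)

lemma integral_D_square: "f \<in> L2_X P \<mu> X \<Longrightarrow> (\<integral>\<omega>. (D k f \<omega>)\<^sup>2 \<partial>P) = derivative_energy f k"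
  unfolding Dk_def derivative_energy_def by (rule integral_diff_T_square)

lemma derivative_energy_nonneg: "f \<in> L2_X P \<mu> X \<Longrightarrow> 0 \<le> derivative_energy f k"
  by (simp flip: integral_D_square)

text \<open>The contraction property of a single \<open>D k\<close>, used to control approximation
  errors one coordinate at a time.\<close>

lemma derivative_energy_le: "f \<in> L2_X P \<mu> X \<Longrightarrow> derivative_energy f k \<le> (\<integral>\<omega>. (f \<omega>)\<^sup>2 \<partial>P)"
  using energy_nonneg[of f "UNIV - {k}"] by (simp add: derivative_energy_def energy_UNIV)

lemma nn_integral_D_square:
  "f \<in> L2_X P \<mu> X \<Longrightarrow> (\<integral>\<^sup>+\<omega>. ennreal ((D k f \<omega>)\<^sup>2) \<partial>P) = ennreal (derivative_energy f k)"
  by (simp add: nn_integral_square_L2 L2_X_L2 L2_X_D integral_D_square)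

lemma AE_D_diff:
  assumes "f \<in> L2_X P \<mu> X" "g \<in> L2_X P \<mu> X"
  shows "AE \<omega> in P. D k (\<lambda>\<omega>. f \<omega> - g \<omega>) \<omega> = D k f \<omega> - D k g \<omega>"
  using T_diff[OF assms[THEN L2_X_L2], of "UNIV - {k}"]
  unfolding Dk_def by eventually_elim simp

lemma nn_integral_kappa:
  assumes [measurable]: "U \<in> borel_measurable (kappa_P_X P \<mu> X)"
  shows "(\<integral>\<^sup>+z. U z \<partial>kappa_P_X P \<mu> X) = (\<Sum>k. \<integral>\<^sup>+\<omega>. U (k, \<omega>) \<partial>P)"
proof -
  interpret PX: prob_space "P_X P \<mu> X" by (rule prob_space_P_X)
  have U: "(\<lambda>\<omega>. U (k, \<omega>)) \<in> borel_measurable (\<F> UNIV)" for k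
  proof -
    have "(\<lambda>\<omega>. U (k, \<omega>)) \<in> borel_measurable (P_X P \<mu> X)"
      using assms unfolding kappa_P_X_def by measurable
    then show ?thesis by (simp cong: measurable_cong_sets add: sets_P_X)
  qed
  have "(\<integral>\<^sup>+z. U z \<partial>kappa_P_X P \<mu> X) = (\<integral>\<^sup>+k. \<integral>\<^sup>+\<omega>. U (k, \<omega>) \<partial>P_X P \<mu> X \<partial>count_space UNIV)"
    using assms unfolding kappa_P_X_def by (rule PX.nn_integral_fst[symmetric])
  also have "\<dots> = (\<Sum>k. \<integral>\<^sup>+\<omega>. U (k, \<omega>) \<partial>P)"
    by (simp add: nn_integral_count_space_nat nn_integral_P_X U)
  finally show ?thesis .
qed

lemma D_seq_measurable:
  assumes "f \<in> L2_X P \<mu> X"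
  shows "D_seq P \<mu> X f \<in> borel_measurable (kappa_P_X P \<mu> X)"
  unfolding kappa_P_X_def
  by (rule measurable_pair_measure_countable1)
    (use L2_X_D[OF assms] in \<open>auto simp: D_seq_def L2_X_def L2_D\<close>)

lemma nn_integral_D_seq_square:
  assumes f: "f \<in> L2_X P \<mu> X"
  shows "(\<integral>\<^sup>+z. ennreal ((D_seq P \<mu> X f z)\<^sup>2) \<partial>kappa_P_X P \<mu> X) = (\<Sum>k. ennreal (derivative_energy f k))"
  using D_seq_measurable[OF f]
  by (subst nn_integral_kappa) (simp_all add: D_seq_def nn_integral_D_square[OF f])

lemma D_seq_L2_iff:
  assumes f: "f \<in> L2_X P \<mu> X"
  shows "D_seq P \<mu> X f \<in> L2 (kappa_P_X P \<mu> X) \<longleftrightarrow> (\<Sum>k. ennreal (derivative_energy f k)) < \<infinity>"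
  unfolding L2_iff_nn_integral nn_integral_D_seq_square[OF f] using D_seq_measurable[OF f] by blast

lemma L2_dist_sq_P_X:
  assumes "f \<in> L2_X P \<mu> X" "g \<in> L2_X P \<mu> X"
  shows "L2_dist_sq (P_X P \<mu> X) f g = ennreal (\<integral>\<omega>. (f \<omega> - g \<omega>)\<^sup>2 \<partial>P)"
proof -
  have [measurable]: "f \<in> borel_measurable (\<F> UNIV)" "g \<in> borel_measurable (\<F> UNIV)"
    using assms by (auto simp: L2_X_iff)
  have "(\<lambda>\<omega>. (f \<omega> - g \<omega>)\<^sup>2) \<in> borel_measurable (\<F> UNIV)"
    by measurable
  from integral_P_X[OF this] show ?thesis
    using assms by (simp add: L2_X_def L2_dist_sq_eq)
qed

lemma L2_dist_sq_D_seq: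
  assumes f: "f \<in> L2_X P \<mu> X" and g: "g \<in> L2_X P \<mu> X"
  shows "L2_dist_sq (kappa_P_X P \<mu> X) (D_seq P \<mu> X f) (D_seq P \<mu> X g) =
    (\<Sum>k. ennreal (derivative_energy (\<lambda>\<omega>. f \<omega> - g \<omega>) k))"
proof -
  note fg = L2_X_diff[OF f g]
  have eq: "(\<integral>\<^sup>+\<omega>. ennreal ((D k f \<omega> - D k g \<omega>)\<^sup>2) \<partial>P) = ennreal (derivative_energy (\<lambda>\<omega>. f \<omega> - g \<omega>) k)" for k
    unfolding nn_integral_D_square[OF fg, symmetric]
    by (intro nn_integral_cong_AE) (use AE_D_diff[OF f g, of k] in \<open>auto elim: eventually_mono\<close>)
  have [measurable]: "D_seq P \<mu> X f \<in> borel_measurable (kappa_P_X P \<mu> X)"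
    "D_seq P \<mu> X g \<in> borel_measurable (kappa_P_X P \<mu> X)"
    by (intro D_seq_measurable f g)+
  have "(\<lambda>z. ennreal ((D_seq P \<mu> X f z - D_seq P \<mu> X g z)\<^sup>2)) \<in> borel_measurable (kappa_P_X P \<mu> X)"
    by measurable
  from nn_integral_kappa[OF this] show ?thesis
    unfolding L2_dist_sq_def by (simp add: D_seq_def eq)
qed

section \<open>The domain of the closure\<close>

lemma cylindrical_T: "f \<in> L2 P \<Longrightarrow> T {..<n} f \<in> cylindrical P \<mu> X"
  unfolding cylindrical_def using L2_X_T borel_measurable_cond_exp[of P "\<F> {..<n}" f] by blast

lemma suminf_derivative_energy_finite_imp_dom_D:
  assumes f: "f \<in> L2_X P \<mu> X" and fin: "(\<Sum>k. ennreal (derivative_energy f k)) < \<infinity>"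
  shows "f \<in> dom_D P \<mu> X"
proof -
  note fP = L2_X_L2[OF f]
  define G where "G n = T {..<n} f" for n
  have G: "G n \<in> cylindrical P \<mu> X" "G n \<in> L2_X P \<mu> X" for n
    unfolding G_def by (intro cylindrical_T L2_X_T fP)+
  have dsum: "summable (derivative_energy f)"
    using fin by (intro summable_suminf_not_top derivative_energy_nonneg f) auto
  \<comment> \<open>The subtracted bracket is nonnegative and tends to
    \<open>derivative_energy f k\<close>. Hence each term is dominated by the summable
    \<open>derivative_energy f k\<close> and tends to 0, as Tannery's theorem demands.\<close>
  have dG: "derivative_energy (\<lambda>\<omega>. f \<omega> - G n \<omega>) k = derivative_energy f k - (energy f {..<n} - energy f ((UNIV - {k}) \<inter> {..<n}))" for n k
    unfolding derivative_energy_def G_def by (simp add: energy_diff_T[OF fP] Int_commute)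
  have sumG: "summable (derivative_energy (\<lambda>\<omega>. f \<omega> - G n \<omega>))" for n
    using derivative_energy_nonneg[OF L2_X_diff[OF f G(2)]] energy_mono[OF fP, of "(UNIV - {k}) \<inter> {..<n}" "{..<n}" for k]
    by (intro summable_comparison_test'[OF dsum, of 0]) (auto simp: dG)
  have "(\<lambda>n. \<Sum>k. derivative_energy (\<lambda>\<omega>. f \<omega> - G n \<omega>) k) \<longlonglongrightarrow> (\<Sum>k::nat. 0)"
  proof (rule tannerys_theorem[THEN conjunct2, THEN conjunct2, OF _ _ dsum])
    show "(\<lambda>n. derivative_energy (\<lambda>\<omega>. f \<omega> - G n \<omega>) k) \<longlonglongrightarrow> 0" for k
    proof -
      have "(\<lambda>n. derivative_energy f k - (energy f {..<n} - energy f ((UNIV - {k}) \<inter> {..<n}))) \<longlonglongrightarrow> derivative_energy f k - (energy f UNIV - energy f (UNIV - {k}))"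
        by (intro tendsto_intros energy_lessThan_tendsto_UNIV energy_Int_lessThan_tendsto f)
      then show ?thesis unfolding dG by (simp add: derivative_energy_def)
    qed
    show "\<forall>\<^sub>F (k, n) in sequentially \<times>\<^sub>F sequentially. norm (derivative_energy (\<lambda>\<omega>. f \<omega> - G n \<omega>) k) \<le> derivative_energy f k"
      using derivative_energy_nonneg[OF L2_X_diff[OF f G(2)]] energy_mono[OF fP, of "(UNIV - {k}) \<inter> {..<n}" "{..<n}" for n k]
      by (intro always_eventually) (auto simp: dG)
  qed simp
  then have lim: "(\<lambda>n. ennreal (\<Sum>k. derivative_energy (\<lambda>\<omega>. f \<omega> - G n \<omega>) k)) \<longlonglongrightarrow> ennreal 0"
    by (intro tendsto_ennrealI) simp
  have "L2_dist_sq (kappa_P_X P \<mu> X) (D_seq P \<mu> X (G n)) (D_seq P \<mu> X f) =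
      ennreal (\<Sum>k. derivative_energy (\<lambda>\<omega>. f \<omega> - G n \<omega>) k)" for n
    using L2_dist_sq_D_seq[OF f G(2)] suminf_ennreal2[OF derivative_energy_nonneg[OF L2_X_diff[OF f G(2)]] sumG]
    by (simp add: L2_dist_sq_commute[of _ "D_seq P \<mu> X (G n)"])
  with lim have "(\<lambda>n. L2_dist_sq (kappa_P_X P \<mu> X) (D_seq P \<mu> X (G n)) (D_seq P \<mu> X f)) \<longlonglongrightarrow> 0"
    by simp
  moreover have "(\<lambda>n. L2_dist_sq (P_X P \<mu> X) (G n) f) \<longlonglongrightarrow> 0"
  proof -
    have "L2_dist_sq (P_X P \<mu> X) (G n) f = ennreal (energy f UNIV - energy f {..<n})" for n
      using L2_dist_sq_P_X[OF f G(2)] integral_diff_T_square[OF f]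
      unfolding L2_dist_sq_commute[of _ "G n"] by (simp add: G_def)
    moreover have "(\<lambda>n. ennreal (energy f UNIV - energy f {..<n})) \<longlonglongrightarrow> ennreal (energy f UNIV - energy f UNIV)"
      by (intro tendsto_intros energy_lessThan_tendsto_UNIV f)
    ultimately show ?thesis by simp
  qed
  moreover have "(G n, D_seq P \<mu> X (G n)) \<in> D_graph P \<mu> X" for n
    unfolding D_graph_def using G by auto
  moreover have "D_seq P \<mu> X f \<in> L2 (kappa_P_X P \<mu> X)"
    using fin by (simp add: D_seq_L2_iff[OF f])
  ultimately have "(f, D_seq P \<mu> X f) \<in> D_closure_graph P \<mu> X"
    unfolding D_closure_graph_def using f
    by (auto intro!: exI[of _ G] exI[of _ "\<lambda>n. D_seq P \<mu> X (G n)"])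
  then show ?thesis unfolding dom_D_def by blast
qed

lemma dom_D_imp_suminf_d_finite:
  assumes "f \<in> dom_D P \<mu> X"
  shows "(\<Sum>k. ennreal (derivative_energy f k)) < \<infinity>"
proof -
  obtain U G V where f: "f \<in> L2_X P \<mu> X" and U: "U \<in> L2 (kappa_P_X P \<mu> X)"
    and GV: "\<And>n::nat. (G n, V n) \<in> D_graph P \<mu> X"
    and Glim: "(\<lambda>n. L2_dist_sq (P_X P \<mu> X) (G n) f) \<longlonglongrightarrow> 0"
    and Vlim: "(\<lambda>n. L2_dist_sq (kappa_P_X P \<mu> X) (V n) U) \<longlonglongrightarrow> 0"
    using assms unfolding dom_D_def D_closure_graph_def by blast
  have V: "V n = D_seq P \<mu> X (G n)" and G: "G n \<in> L2_X P \<mu> X" for n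
    using GV[of n] by (auto simp: D_graph_def cylindrical_def)
  define C where "C = (\<integral>z. (U z)\<^sup>2 \<partial>kappa_P_X P \<mu> X)"
  \<comment> \<open>Squares of sums cost a factor 2: the errors of f contribute at most 2 K / (K +
    1) \<le> 2, and the approximating element at most 2 (2 + 2 C).\<close>
  have bound: "(\<Sum>k<K. derivative_energy f k) \<le> 6 + 4 * C" for K :: nat
  proof -
    \<comment> \<open>The accuracy depends on \<open>K\<close>, because the same L^2-error is
      charged once for each of the \<open>K\<close> coordinates; the resulting bound does not depend
      on \<open>K\<close>.\<close>
    have "\<forall>\<^sub>F n in sequentially. L2_dist_sq (P_X P \<mu> X) (G n) f < ennreal (1 / real (Suc K))"
      by (rule order_tendstoD(2)[OF Glim]) simp
    moreover have "\<forall>\<^sub>F n in sequentially. L2_dist_sq (kappa_P_X P \<mu> X) (V n) U < ennreal 1"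
      by (rule order_tendstoD(2)[OF Vlim]) simp
    ultimately have "\<forall>\<^sub>F n in sequentially. L2_dist_sq (P_X P \<mu> X) (G n) f < ennreal (1 / real (Suc K)) \<and>
        L2_dist_sq (kappa_P_X P \<mu> X) (V n) U < ennreal 1"
      by (rule eventually_conj)
    then obtain n where n: "L2_dist_sq (P_X P \<mu> X) (G n) f < ennreal (1 / real (Suc K))"
      "L2_dist_sq (kappa_P_X P \<mu> X) (V n) U < ennreal 1"
      by (auto simp: eventually_sequentially)
    have Gf: "(\<integral>\<omega>. (f \<omega> - G n \<omega>)\<^sup>2 \<partial>P) \<le> 1 / real (Suc K)"
      using n(1) L2_dist_sq_P_X[OF G f, of n] by (simp add: power2_commute ennreal_less_iff)
    have Vm: "V n \<in> borel_measurable (kappa_P_X P \<mu> X)"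
      unfolding V by (rule D_seq_measurable[OF G])
    \<comment> \<open>\<open>D_graph\<close> does not record square integrability of the derivative
      sequence; it follows from finite distance to \<open>U\<close>.\<close>
    have VU: "(\<lambda>z. V n z - U z) \<in> L2 (kappa_P_X P \<mu> X)"
      unfolding L2_iff_nn_integral using Vm L2_D[OF U] n(2)
      by (auto simp: L2_dist_sq_def intro: less_trans)
    have "(\<integral>z. (V n z - U z)\<^sup>2 \<partial>kappa_P_X P \<mu> X) \<le> 1"
      using n(2) nn_integral_square_L2[OF VU] by (simp add: L2_dist_sq_def ennreal_less_iff)
    moreover have VL2: "V n \<in> L2 (kappa_P_X P \<mu> X)" using L2_add[OF VU U] by simp
    moreover have "(\<integral>z. (V n z)\<^sup>2 \<partial>kappa_P_X P \<mu> X) \<le>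
        2 * (\<integral>z. (V n z - U z)\<^sup>2 \<partial>kappa_P_X P \<mu> X) + 2 * C"
      using L2_norm_add_le[OF VU U] by (simp add: C_def)
    ultimately have Vn: "(\<integral>z. (V n z)\<^sup>2 \<partial>kappa_P_X P \<mu> X) \<le> 2 + 2 * C" by simp
    have "ennreal (\<Sum>k<K. derivative_energy (G n) k) = (\<Sum>k<K. ennreal (derivative_energy (G n) k))"
      by (rule sum_ennreal[symmetric]) (rule derivative_energy_nonneg[OF G])
    also have "\<dots> \<le> (\<Sum>k. ennreal (derivative_energy (G n) k))"
      by (intro sum_le_suminf) auto
    also have "\<dots> = ennreal (\<integral>z. (V n z)\<^sup>2 \<partial>kappa_P_X P \<mu> X)"
      using nn_integral_D_seq_square[OF G[of n]] nn_integral_square_L2[OF VL2] by (simp add: V)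
    finally have sG: "(\<Sum>k<K. derivative_energy (G n) k) \<le> 2 + 2 * C"
      using Vn by (subst (asm) ennreal_le_iff) auto
    have "derivative_energy f k \<le> 2 * (1 / real (Suc K)) + 2 * derivative_energy (G n) k" for k
    proof -
      note fG = L2_X_diff[OF f G[of n]]
      have [measurable]: "D k g \<in> borel_measurable P" if "g \<in> L2_X P \<mu> X" for g
        using L2_D(1)[OF L2_X_L2[OF L2_X_D[OF that]]] .
      have "derivative_energy f k = (\<integral>\<omega>. (D k (\<lambda>\<omega>. f \<omega> - G n \<omega>) \<omega> + D k (G n) \<omega>)\<^sup>2 \<partial>P)"
        unfolding integral_D_square[OF f, symmetric]
        by (rule Bochner_Integration.integral_cong_AE)
          (use f G fG AE_D_diff[OF f G[of n], of k] in \<open>auto elim: eventually_mono\<close>)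
      also have "\<dots> \<le> 2 * derivative_energy (\<lambda>\<omega>. f \<omega> - G n \<omega>) k + 2 * derivative_energy (G n) k"
        using L2_norm_add_le[OF L2_X_L2[OF L2_X_D[OF fG]] L2_X_L2[OF L2_X_D[OF G[of n]]], of k k]
        by (simp add: integral_D_square fG G)
      finally show ?thesis using derivative_energy_le[OF fG, of k] Gf by linarith
    qed
    then have "(\<Sum>k<K. derivative_energy f k) \<le> (\<Sum>k<K. 2 * (1 / real (Suc K)) + 2 * derivative_energy (G n) k)"
      by (rule sum_mono)
    also have "\<dots> = 2 * (real K / real (Suc K)) + 2 * (\<Sum>k<K. derivative_energy (G n) k)"
      by (simp add: sum.distrib sum_distrib_left)
    also have "\<dots> \<le> 2 * 1 + 2 * (2 + 2 * C)"
      using sG by (intro add_mono mult_left_mono) simp_all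
    finally show ?thesis by simp
  qed
  have "summable (derivative_energy f)"
  proof (rule bounded_imp_summable)
    show "0 \<le> derivative_energy f k" for k by (rule derivative_energy_nonneg[OF f])
    show "(\<Sum>k\<le>n. derivative_energy f k) \<le> 6 + 4 * C" for n
      using bound[of "Suc n"] by (simp add: lessThan_Suc_atMost)
  qed
  then show ?thesis by (simp add: suminf_ennreal2 derivative_energy_nonneg[OF f])
qed


section \<open>Resampling one coordinate\<close>

lemma L2_mix: "f \<in> L2 S \<Longrightarrow> (\<lambda>z. f (mix L (fst z) (snd z))) \<in> L2 (S \<Otimes>\<^sub>M S)"
  using measurable_compose[OF measurable_case_mix, of f borel L] integrable_mix[of "\<lambda>x. (f x)\<^sup>2" L]
  by (simp add: L2_def)

text \<open>The spliced and the original value have the same squared norm, which accounts for the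
  factor 2; by Fubini their inner product is that of F with its projection, that is,
  \<open>energy F L\<close>.\<close>

lemma integral_mix_diff_square:
  assumes f: "f \<in> L2 S" and F: "F \<in> L2_X P \<mu> X" and eq: "AE \<omega> in P. F \<omega> = f (X \<omega>)"
  shows "(\<integral>z. (f (mix L (fst z) (snd z)) - f (fst z))\<^sup>2 \<partial>(S \<Otimes>\<^sub>M S)) = 2 * (energy F UNIV - energy F L)"
proof -
  have [measurable]: "f \<in> borel_measurable S" using L2_D[OF f] by simp
  have FP: "F \<in> L2 P" using F by (rule L2_X_L2)
  then have [measurable]: "F \<in> borel_measurable P" by (rule L2_D)
  define u where "u L z = f (mix L (fst z) (snd z))" for L and z :: "(nat \<Rightarrow> 'a) \<times> (nat \<Rightarrow> 'a)"
  have u: "u L \<in> L2 (S \<Otimes>\<^sub>M S)" for L unfolding u_def by (rule L2_mix[OF f])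
  have mixU: "mix UNIV x y = x" for x y :: "nat \<Rightarrow> 'a" by (simp add: mix_def)
  have uU: "u UNIV z = f (fst z)" for z by (simp add: u_def mixU)
  have sq: "(\<integral>z. (u L z)\<^sup>2 \<partial>(S \<Otimes>\<^sub>M S)) = energy F UNIV" for L
  proof -
    have "(\<integral>z. (u L z)\<^sup>2 \<partial>(S \<Otimes>\<^sub>M S)) = (\<integral>x. (f x)\<^sup>2 \<partial>S)"
      unfolding u_def by (rule integral_mix) measurable
    also have "\<dots> = (\<integral>\<omega>. (f (X \<omega>))\<^sup>2 \<partial>P)" by (rule integral_X[symmetric]) measurable
    also have "\<dots> = (\<integral>\<omega>. (F \<omega>)\<^sup>2 \<partial>P)"
      by (rule Bochner_Integration.integral_cong_AE) (use eq in \<open>auto elim: eventually_mono\<close>)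
    finally show ?thesis by (simp add: energy_UNIV[OF F])
  qed
  define g where "g x = (\<integral>y. f (mix L x y) \<partial>S)" for x
  have [measurable]: "g \<in> borel_measurable S" unfolding g_def by measurable
  have "integrable S f" using L2_D[OF f] by (rule S.square_integrable_imp_integrable)
  from cond_exp_mix[OF this, of L]
  have "AE \<omega> in P. T L (\<lambda>\<omega>. f (X \<omega>)) \<omega> = g (X \<omega>)" by (simp add: g_def)
  moreover have "AE \<omega> in P. T L F \<omega> = T L (\<lambda>\<omega>. f (X \<omega>)) \<omega>"
    by (rule cond.real_cond_exp_cong[OF eq]) measurable
  ultimately have TF: "AE \<omega> in P. T L F \<omega> = g (X \<omega>)" by eventually_elim simp
  have "(\<integral>z. u UNIV z * u L z \<partial>(S \<Otimes>\<^sub>M S)) = (\<integral>x. \<integral>y. f x * f (mix L x y) \<partial>S \<partial>S)"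
    using SS.integral_fst'[OF L2_mult_integrable[OF u u], of UNIV L]
    by (simp add: uU) (simp add: u_def)
  also have "\<dots> = (\<integral>x. f x * g x \<partial>S)"
    by (simp add: g_def)
  also have "\<dots> = (\<integral>\<omega>. f (X \<omega>) * g (X \<omega>) \<partial>P)"
    by (rule integral_X[symmetric]) measurable
  also have "\<dots> = (\<integral>\<omega>. T L F \<omega> * F \<omega> \<partial>P)"
    by (rule Bochner_Integration.integral_cong_AE)
      (use eq TF in \<open>auto elim: eventually_elim2\<close>)
  also have "\<dots> = (\<integral>\<omega>. T L F \<omega> * T L F \<omega> \<partial>P)"
    by (intro integral_mult_T[symmetric] L2_T FP) simp
  finally have cross: "(\<integral>z. u UNIV z * u L z \<partial>(S \<Otimes>\<^sub>M S)) = energy F L"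
    by (simp add: energy_def power2_eq_square)
  have "(\<integral>z. (u L z - u UNIV z)\<^sup>2 \<partial>(S \<Otimes>\<^sub>M S)) =
      (\<integral>z. (u L z)\<^sup>2 - 2 * (u UNIV z * u L z) + (u UNIV z)\<^sup>2 \<partial>(S \<Otimes>\<^sub>M S))"
    by (simp add: power2_diff algebra_simps)
  also have "\<dots> = energy F UNIV - 2 * energy F L + energy F UNIV"
    using L2_D[OF u] L2_mult_integrable[OF u u] by (simp add: sq cross)
  finally show ?thesis unfolding uU by (simp add: u_def)
qed

text \<open>Independence makes the joint law of \<open>(X, X')\<close> the product of \<mu> with
  itself, and updating coordinate \<open>k\<close> is splicing along the complement of
  \<open>{k}\<close>.\<close>

lemma nn_integral_resample:
  assumes X': "indep_var S X S X'" "distr P S X' = S"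
    and F: "F \<in> L2_X P \<mu> X" and rep: "representative P \<mu> X F f"
  shows "(\<integral>\<^sup>+\<omega>. ennreal ((f ((X \<omega>)(k := X' \<omega> k)) - f (X \<omega>))\<^sup>2) \<partial>P) = ennreal (2 * derivative_energy F k)"
proof -
  have f: "f \<in> L2 S" and eq: "AE \<omega> in P. F \<omega> = f (X \<omega>)"
    using rep by (auto simp: representative_def)
  have [measurable]: "f \<in> borel_measurable S" using L2_D[OF f] by simp
  have [measurable]: "X' \<in> P \<rightarrow>\<^sub>M S" using X'(1) by (rule indep_var_rv2)
  have joint: "distr P (S \<Otimes>\<^sub>M S) (\<lambda>\<omega>. (X \<omega>, X' \<omega>)) = S \<Otimes>\<^sub>M S"
    using X' distr_X by (simp add: indep_var_distribution_eq)
  let ?L = "UNIV - {k}"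
  have mix: "(X \<omega>)(k := X' \<omega> k) = mix ?L (X \<omega>) (X' \<omega>)" for \<omega>
    by (auto simp: mix_def)
  let ?u = "\<lambda>z. f (mix ?L (fst z) (snd z)) - f (fst z)"
  have "(\<lambda>z. f (mix UNIV (fst z) (snd z))) \<in> L2 (S \<Otimes>\<^sub>M S)" by (rule L2_mix[OF f])
  then have u: "?u \<in> L2 (S \<Otimes>\<^sub>M S)"
    using L2_diff[OF L2_mix[OF f, of ?L]] by (simp add: mix_def)
  have "(\<integral>\<^sup>+\<omega>. ennreal ((f ((X \<omega>)(k := X' \<omega> k)) - f (X \<omega>))\<^sup>2) \<partial>P) =
      (\<integral>\<^sup>+z. ennreal ((?u z)\<^sup>2) \<partial>distr P (S \<Otimes>\<^sub>M S) (\<lambda>\<omega>. (X \<omega>, X' \<omega>)))"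
    unfolding mix by (subst nn_integral_distr) simp_all
  also have "\<dots> = ennreal (2 * derivative_energy F k)"
    unfolding joint derivative_energy_def using nn_integral_square_L2[OF u] integral_mix_diff_square[OF f F eq, of ?L]
    by simp
  finally show ?thesis .
qed

text \<open>Existence keeps the version of (iii) for every representative from being
  vacuous.\<close>

lemma representative_exists:
  assumes F: "F \<in> L2_X P \<mu> X"
  obtains f where "representative P \<mu> X F f"
proof -
  have "F \<in> borel_measurable (vimage_algebra (space P) X S)"
    using F by (simp add: L2_X_iff cong: measurable_cong_sets) (simp add: sets_vimage_algebra_X cong: measurable_cong_sets)
  moreover have "X \<in> space P \<rightarrow> space S" using X_in_space by auto
  ultimately obtain f where f [measurable]: "f \<in> borel_measurable S"
    and Ff: "\<And>\<omega>. \<omega> \<in> space P \<Longrightarrow> F \<omega> = f (X \<omega>)"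
    using borel_measurable_vimage_algebra_factor by metis
  have "integrable P (\<lambda>\<omega>. (f (X \<omega>))\<^sup>2)"
    using L2_D(2)[OF L2_X_L2[OF F]] Ff
    by (subst Bochner_Integration.integrable_cong[where g="\<lambda>\<omega>. (F \<omega>)\<^sup>2"]) auto
  then have "f \<in> L2 S" using integrable_X_iff[of "\<lambda>x. (f x)\<^sup>2"] by (simp add: L2_def)
  then have "representative P \<mu> X F f"
    unfolding representative_def using Ff by (auto intro: AE_I2)
  then show ?thesis by (rule that)
qed

lemma suminf_resample_finite_iff:
  assumes X': "indep_var S X S X'" "distr P S X' = S"
    and F: "F \<in> L2_X P \<mu> X" and rep: "representative P \<mu> X F f"
  shows "(\<Sum>k. \<integral>\<^sup>+\<omega>. ennreal ((f ((X \<omega>)(k := X' \<omega> k)) - f (X \<omega>))\<^sup>2) \<partial>P) < \<infinity> \<longleftrightarrow>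
    (\<Sum>k. ennreal (derivative_energy F k)) < \<infinity>"
proof -
  have "(\<Sum>k. ennreal (2 * derivative_energy F k)) = 2 * (\<Sum>k. ennreal (derivative_energy F k))"
    by (simp add: ennreal_mult derivative_energy_nonneg[OF F] ennreal_suminf_cmult)
  then show ?thesis
    unfolding nn_integral_resample[OF assms]
    by (simp add: ennreal_mult_less_top less_top[symmetric] ennreal_mult_eq_top_iff)
qed

section \<open>Convergence of Hoeffding series and the Parseval identity\<close>

lemma integral_P_X_square:
  assumes "f \<in> L2 (P_X P \<mu> X)"
  shows "(\<integral>\<omega>. (f \<omega>)\<^sup>2 \<partial>P_X P \<mu> X) = (\<integral>\<omega>. (f \<omega>)\<^sup>2 \<partial>P)"
proof (rule integral_P_X)
  have [measurable]: "f \<in> borel_measurable (\<F> UNIV)" using assms by (simp add: L2_P_X_iff)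
  show "(\<lambda>\<omega>. (f \<omega>)\<^sup>2) \<in> borel_measurable (\<F> UNIV)" by measurable
qed

lemma summable_on_component_energy:
  assumes f: "f \<in> L2_X P \<mu> X" and A: "A \<subseteq> {M. finite M}"
  shows "component_energy f summable_on A"
  using has_sum_imp_summable[OF has_sum_component_energy[OF f, of UNIV]] A by (auto intro: summable_on_subset)

text \<open>By orthogonality the squared distance of nested partial sums is a difference of sums of
  component energies. Completeness gives a limit along a sequence of finite families, and comparison
  with larger members of that sequence extends convergence to the whole net.\<close>

lemma L2_has_sum_Hoeffding_exists:
  assumes f: "f \<in> L2_X P \<mu> X" and A: "A \<subseteq> {M. finite M}"
  shows "\<exists>G. L2_has_sum (P_X P \<mu> X) (H f) A G"
proof -
  note fP = L2_X_L2[OF f]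
  define s where "s Y \<omega> = (\<Sum>M\<in>Y. H f M \<omega>)" for Y \<omega>
  have s: "s Y \<in> L2 (P_X P \<mu> X)" for Y
    unfolding s_def using L2_X_Hoeffding[OF fP] by (intro L2_sum) (simp add: L2_X_def)
  have s_dist: "(\<integral>\<omega>. (s Y \<omega> - s Z \<omega>)\<^sup>2 \<partial>P_X P \<mu> X) = sum (component_energy f) Y - sum (component_energy f) Z"
    if "finite Y" "Y \<subseteq> A" "Z \<subseteq> Y" for Y Z
  proof -
    have "(\<integral>\<omega>. (s Y \<omega> - s Z \<omega>)\<^sup>2 \<partial>P_X P \<mu> X) = (\<integral>\<omega>. (s (Y - Z) \<omega>)\<^sup>2 \<partial>P_X P \<mu> X)"
      using that by (simp add: s_def sum_diff)
    also have "\<dots> = (\<integral>\<omega>. (s (Y - Z) \<omega>)\<^sup>2 \<partial>P)"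
      by (rule integral_P_X_square[OF s])
    also have "\<dots> = sum (component_energy f) (Y - Z)"
      unfolding s_def using that A by (intro integral_sum_Hoeffding_square fP) auto
    also have "\<dots> = sum (component_energy f) Y - sum (component_energy f) Z"
      using that by (simp add: sum_diff)
    finally show ?thesis .
  qed
  define B where "B n = {M \<in> A. M \<subseteq> {..<n}}" for n :: nat
  have B: "finite (B n)" "B n \<subseteq> A" for n
    unfolding B_def by (auto intro: finite_subset[of _ "Pow {..<n}"])
  have B_mono: "B m \<subseteq> B n" if "m \<le> n" for m n
    using that by (auto simp: B_def)
  have B_lim: "filterlim B (finite_subsets_at_top A) sequentially"
    unfolding B_def by (rule filterlim_sets_below[OF A])
  have B_exhaust: "\<forall>\<^sub>F n in sequentially. Y \<subseteq> B n" if "finite Y" "Y \<subseteq> A" for Y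
  proof -
    have "\<forall>\<^sub>F n in sequentially. finite (B n) \<and> Y \<subseteq> B n \<and> B n \<subseteq> A"
      using B_lim that unfolding filterlim_finite_subsets_at_top by blast
    then show ?thesis by (rule eventually_mono) blast
  qed
  have lim: "(sum (component_energy f) \<longlongrightarrow> infsum (component_energy f) A) (finite_subsets_at_top A)"
    using has_sum_infsum[OF summable_on_component_energy[OF f A]] by (simp add: has_sum_def)
  have limB: "(\<lambda>n. sum (component_energy f) (B n)) \<longlonglongrightarrow> infsum (component_energy f) A"
    by (rule filterlim_compose[OF lim B_lim])
  obtain G where G: "G \<in> L2 (P_X P \<mu> X)"
    and Glim: "(\<lambda>n. \<integral>\<omega>. (s (B n) \<omega> - G \<omega>)\<^sup>2 \<partial>P_X P \<mu> X) \<longlonglongrightarrow> 0"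
  proof (rule L2_complete[of "\<lambda>n. s (B n)" "P_X P \<mu> X"])
    fix e :: real assume "e > 0"
    with LIMSEQ_imp_Cauchy[OF limB]
    obtain N where N: "\<And>m n. m \<ge> N \<Longrightarrow> n \<ge> N \<Longrightarrow> \<bar>sum (component_energy f) (B m) - sum (component_energy f) (B n)\<bar> < e"
      unfolding Cauchy_def dist_real_def by blast
    have dist: "(\<integral>\<omega>. (s (B m) \<omega> - s (B n) \<omega>)\<^sup>2 \<partial>P_X P \<mu> X) < e" if "m \<ge> N" "n \<ge> N" "n \<le> m" for m n
      using N[OF that(1,2)] by (subst s_dist[OF B B_mono[OF that(3)]]) simp
    have "(\<integral>\<omega>. (s (B m) \<omega> - s (B n) \<omega>)\<^sup>2 \<partial>P_X P \<mu> X) < e" if "m \<ge> N" "n \<ge> N" for m n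
    proof (cases "n \<le> m")
      case True then show ?thesis using dist that by simp
    next
      case False then show ?thesis using dist[of n m] that by (simp add: power2_commute)
    qed
    then show "\<exists>N. \<forall>m\<ge>N. \<forall>n\<ge>N. (\<integral>\<omega>. (s (B m) \<omega> - s (B n) \<omega>)\<^sup>2 \<partial>P_X P \<mu> X) < e"
      by blast
  qed (rule s)
  have "((\<lambda>Y. \<integral>\<omega>. (s Y \<omega> - G \<omega>)\<^sup>2 \<partial>P_X P \<mu> X) \<longlongrightarrow> 0) (finite_subsets_at_top A)"
  proof (rule tendsto_sandwich[OF _ _ tendsto_const])
    \<comment> \<open>The intermediate point \<open>s (B n)\<close> with
      \<open>B n \<supseteq> Y\<close> costs the factor 2; its own distance to \<open>G\<close>
      disappears as \<open>n\<close> grows, leaving the tail of the component energies.\<close>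
    show "\<forall>\<^sub>F Y in finite_subsets_at_top A.
        (\<integral>\<omega>. (s Y \<omega> - G \<omega>)\<^sup>2 \<partial>P_X P \<mu> X) \<le> 2 * (infsum (component_energy f) A - sum (component_energy f) Y)"
    proof (rule eventually_finite_subsets_at_top_weakI)
      fix Y assume Y: "finite Y" "Y \<subseteq> A"
      have "\<forall>\<^sub>F n in sequentially. (\<integral>\<omega>. (s Y \<omega> - G \<omega>)\<^sup>2 \<partial>P_X P \<mu> X) \<le>
          2 * (sum (component_energy f) (B n) - sum (component_energy f) Y) + 2 * (\<integral>\<omega>. (s (B n) \<omega> - G \<omega>)\<^sup>2 \<partial>P_X P \<mu> X)"
        using B_exhaust[OF Y]
      proof eventually_elim
        case (elim n)
        have "(\<integral>\<omega>. (s Y \<omega> - G \<omega>)\<^sup>2 \<partial>P_X P \<mu> X) \<le>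
            2 * (\<integral>\<omega>. (s Y \<omega> - s (B n) \<omega>)\<^sup>2 \<partial>P_X P \<mu> X) + 2 * (\<integral>\<omega>. (s (B n) \<omega> - G \<omega>)\<^sup>2 \<partial>P_X P \<mu> X)"
          using L2_norm_add_le[OF L2_diff[OF s[of Y] s[of "B n"]] L2_diff[OF s[of "B n"] G]] by simp
        also have "(\<integral>\<omega>. (s Y \<omega> - s (B n) \<omega>)\<^sup>2 \<partial>P_X P \<mu> X) = sum (component_energy f) (B n) - sum (component_energy f) Y"
          using s_dist[OF B elim] by (simp add: power2_commute)
        finally show ?case .
      qed
      moreover have "(\<lambda>n. 2 * (sum (component_energy f) (B n) - sum (component_energy f) Y) + 2 * (\<integral>\<omega>. (s (B n) \<omega> - G \<omega>)\<^sup>2 \<partial>P_X P \<mu> X))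
          \<longlonglongrightarrow> 2 * (infsum (component_energy f) A - sum (component_energy f) Y) + 2 * 0"
        by (intro tendsto_intros limB Glim)
      ultimately show "(\<integral>\<omega>. (s Y \<omega> - G \<omega>)\<^sup>2 \<partial>P_X P \<mu> X) \<le> 2 * (infsum (component_energy f) A - sum (component_energy f) Y)"
        using tendsto_lowerbound[OF _ _ sequentially_bot] by fastforce
    qed
    have "((\<lambda>Y. 2 * (infsum (component_energy f) A - sum (component_energy f) Y)) \<longlongrightarrow> 2 * (infsum (component_energy f) A - infsum (component_energy f) A)) (finite_subsets_at_top A)"
      by (intro tendsto_intros lim)
    then show "((\<lambda>Y. 2 * (infsum (component_energy f) A - sum (component_energy f) Y)) \<longlongrightarrow> 0) (finite_subsets_at_top A)" by simp
  qed simp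
  from tendsto_ennrealI[OF this]
  have "((\<lambda>Y. L2_dist_sq (P_X P \<mu> X) (s Y) G) \<longlongrightarrow> 0) (finite_subsets_at_top A)"
    by (simp add: L2_dist_sq_eq[OF s G])
  then have "L2_has_sum (P_X P \<mu> X) (H f) A G"
    using G unfolding L2_has_sum_def s_def by simp
  then show ?thesis by (rule exI[of _ G])
qed

text \<open>Parseval for an arbitrary version \<open>G\<close> of the sum, hence also for the one
  picked by \<open>SOME\<close>.\<close>

lemma L2_has_sum_Hoeffding_square:
  assumes f: "f \<in> L2_X P \<mu> X" and A: "A \<subseteq> {M. finite M}"
    and G: "L2_has_sum (P_X P \<mu> X) (H f) A G"
  shows "(component_energy f has_sum (\<integral>\<omega>. (G \<omega>)\<^sup>2 \<partial>P)) A"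
proof -
  note fP = L2_X_L2[OF f]
  let ?s = "\<lambda>Y \<omega>. \<Sum>M\<in>Y. H f M \<omega>"
  have GL2: "G \<in> L2 (P_X P \<mu> X)" using G by (simp add: L2_has_sum_def)
  have s: "?s Y \<in> L2 (P_X P \<mu> X)" for Y
    using L2_X_Hoeffding[OF fP] by (intro L2_sum) (simp add: L2_X_def)
  have "((\<lambda>Y. ennreal (\<integral>\<omega>. (?s Y \<omega> - G \<omega>)\<^sup>2 \<partial>P_X P \<mu> X)) \<longlongrightarrow> ennreal 0) (finite_subsets_at_top A)"
    using G by (simp add: L2_has_sum_def L2_dist_sq_eq[OF s GL2])
  then have "((\<lambda>Y. \<integral>\<omega>. (?s Y \<omega> - G \<omega>)\<^sup>2 \<partial>P_X P \<mu> X) \<longlongrightarrow> 0) (finite_subsets_at_top A)"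
    by (rule tendsto_ennrealD) simp_all
  from L2_norm_tendsto[OF s GL2 this]
  have "((\<lambda>Y. \<integral>\<omega>. (?s Y \<omega>)\<^sup>2 \<partial>P_X P \<mu> X) \<longlongrightarrow> (\<integral>\<omega>. (G \<omega>)\<^sup>2 \<partial>P_X P \<mu> X)) (finite_subsets_at_top A)" .
  moreover have "\<forall>\<^sub>F Y in finite_subsets_at_top A. (\<integral>\<omega>. (?s Y \<omega>)\<^sup>2 \<partial>P_X P \<mu> X) = sum (component_energy f) Y"
  proof (rule eventually_finite_subsets_at_top_weakI)
    fix Y assume Y: "finite Y" "Y \<subseteq> A"
    have "(\<integral>\<omega>. (?s Y \<omega>)\<^sup>2 \<partial>P_X P \<mu> X) = (\<integral>\<omega>. (?s Y \<omega>)\<^sup>2 \<partial>P)"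
      by (rule integral_P_X_square[OF s])
    also have "\<dots> = sum (component_energy f) Y"
      using Y A by (intro integral_sum_Hoeffding_square fP) auto
    finally show "(\<integral>\<omega>. (?s Y \<omega>)\<^sup>2 \<partial>P_X P \<mu> X) = sum (component_energy f) Y" .
  qed
  ultimately have "(sum (component_energy f) \<longlongrightarrow> (\<integral>\<omega>. (G \<omega>)\<^sup>2 \<partial>P_X P \<mu> X)) (finite_subsets_at_top A)"
    by (rule Lim_transform_eventually)
  moreover have "(\<integral>\<omega>. (G \<omega>)\<^sup>2 \<partial>P_X P \<mu> X) = (\<integral>\<omega>. (G \<omega>)\<^sup>2 \<partial>P)"
    by (rule integral_P_X_square[OF GL2])
  ultimately show ?thesis by (simp add: has_sum_def)
qed

abbreviation w :: "('w \<Rightarrow> real) \<Rightarrow> nat set \<Rightarrow> ennreal" where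
  "w f M \<equiv> ennreal (component_energy f M)"

text \<open>Sums over finite sets are written as nonnegative integrals, so that they can be
  exchanged with series by monotone convergence even when infinite.\<close>

abbreviation fin_sets :: "nat set measure" where
  "fin_sets \<equiv> count_space {M. finite M}"

lemma nn_integral_fin_sets:
  assumes f: "f \<in> L2_X P \<mu> X" and A: "A \<subseteq> {M. finite M}" and s: "(component_energy f has_sum s) A"
  shows "(\<integral>\<^sup>+M. w f M * indicator A M \<partial>fin_sets) = ennreal s"
proof -
  have "countable {M::nat set. finite M}" by (rule countable_Collect_finite)
  then have "countable A" using A countable_subset by blast
  have "(\<integral>\<^sup>+M. w f M * indicator A M \<partial>fin_sets) = (\<integral>\<^sup>+M. w f M \<partial>count_space A)"
  proof -
    have "A \<inter> {M. finite M} = A" using A by auto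
    then show ?thesis
      using nn_integral_restrict_space[of A fin_sets "w f"] A
      by (simp add: restrict_count_space)
  qed
  also have "\<dots> = (\<Sum>\<^sub>\<infinity>M\<in>A. w f M)"
    by (rule nn_integral_count_space_eq_infsum) fact
  also have "\<dots> = ennreal s"
    using A by (intro infsum_ennreal_eq s component_energy_nonneg L2_X_L2 f) auto
  finally show ?thesis .
qed

text \<open>The sets avoiding \<open>k\<close> carry exactly \<open>energy f (UNIV - {k})\<close>;
  removing them from all finite sets leaves the derivative.\<close>

lemma has_sum_component_energy_mem:
  assumes f: "f \<in> L2_X P \<mu> X"
  shows "(component_energy f has_sum derivative_energy f k) {M. finite M \<and> k \<in> M}"
proof -
  have "(component_energy f has_sum (energy f UNIV - energy f (UNIV - {k}))) ({M. finite M \<and> M \<subseteq> UNIV} - {M. finite M \<and> M \<subseteq> UNIV - {k}})"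
    by (intro has_sum_Diff has_sum_component_energy f) auto
  moreover have "{M. finite M \<and> M \<subseteq> UNIV} - {M. finite M \<and> M \<subseteq> UNIV - {k}} = {M. finite M \<and> k \<in> M}"
    by auto
  ultimately show ?thesis by (simp only: derivative_energy_def)
qed

lemma suminf_indicator_mem:
  assumes "finite M"
  shows "(\<Sum>k. indicator {M. finite M \<and> k \<in> M} M :: ennreal) = of_nat (card M)"
proof -
  have "(\<Sum>k. indicator {M. finite M \<and> k \<in> M} M :: ennreal) =
      (\<Sum>k\<in>M. indicator {M. finite M \<and> k \<in> M} M)"
    by (rule suminf_finite[OF assms]) auto
  then show ?thesis using assms by simp
qed

text \<open>Double counting of the pairs with \<open>k \<in> M\<close>: each \<open>M\<close> is met
  once for each of its elements.\<close>

lemma suminf_derivative_energy_eq: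
  assumes f: "f \<in> L2_X P \<mu> X"
  shows "(\<Sum>k. ennreal (derivative_energy f k)) = (\<integral>\<^sup>+M. of_nat (card M) * w f M \<partial>fin_sets)"
proof -
  have "(\<Sum>k. ennreal (derivative_energy f k)) = (\<Sum>k. \<integral>\<^sup>+M. w f M * indicator {M. finite M \<and> k \<in> M} M \<partial>fin_sets)"
    by (intro suminf_cong nn_integral_fin_sets[symmetric] has_sum_component_energy_mem f) auto
  also have "\<dots> = (\<integral>\<^sup>+M. (\<Sum>k. w f M * indicator {M. finite M \<and> k \<in> M} M) \<partial>fin_sets)"
    by (rule nn_integral_suminf[symmetric]) simp
  also have "\<dots> = (\<integral>\<^sup>+M. of_nat (card M) * w f M \<partial>fin_sets)"
    by (intro nn_integral_cong) (simp add: ennreal_suminf_cmult suminf_indicator_mem mult.commute)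
  finally show ?thesis .
qed

lemma infsum_card_component_energy:
  assumes f: "f \<in> L2_X P \<mu> X"
  shows "(\<Sum>\<^sub>\<infinity>M\<in>{M. finite M}. of_nat (card M) * (\<integral>\<^sup>+\<omega>. ennreal ((H f M \<omega>)\<^sup>2) \<partial>P)) =
    (\<Sum>k. ennreal (derivative_energy f k))"
proof -
  note fP = L2_X_L2[OF f]
  have "(\<Sum>\<^sub>\<infinity>M\<in>{M. finite M}. of_nat (card M) * (\<integral>\<^sup>+\<omega>. ennreal ((H f M \<omega>)\<^sup>2) \<partial>P)) =
      (\<Sum>\<^sub>\<infinity>M\<in>{M. finite M}. of_nat (card M) * w f M)"
    using nn_integral_square_L2[OF L2_X_L2[OF L2_X_Hoeffding[OF fP]]] component_energy_eq[OF fP]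
    by (intro infsum_cong) simp
  then show ?thesis
    unfolding suminf_derivative_energy_eq[OF f]
    using nn_integral_count_space_eq_infsum[OF countable_Collect_finite, of "\<lambda>M. of_nat (card M) * w f M"]
    by simp
qed

lemma nn_integral_Hoeffding_proj:
  assumes f: "f \<in> L2_X P \<mu> X"
  shows "(\<integral>\<^sup>+\<omega>. ennreal ((Hoeffding_proj P \<mu> X p f \<omega>)\<^sup>2) \<partial>P) =
    (\<integral>\<^sup>+M. w f M * indicator {M. finite M \<and> card M = p} M \<partial>fin_sets)"
proof -
  let ?A = "{M::nat set. finite M \<and> card M = p}"
  have A: "?A \<subseteq> {M. finite M}" by auto
  have G: "L2_has_sum (P_X P \<mu> X) (H f) ?A (Hoeffding_proj P \<mu> X p f)"
    unfolding Hoeffding_proj_def by (rule someI_ex[OF L2_has_sum_Hoeffding_exists[OF f A]])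
  then have "Hoeffding_proj P \<mu> X p f \<in> L2 P"
    by (simp add: L2_has_sum_def L2_P_X_iff)
  then show ?thesis
    using nn_integral_fin_sets[OF f A L2_has_sum_Hoeffding_square[OF f A G]]
    by (simp add: nn_integral_square_L2)
qed

text \<open>Finite sets are grouped by cardinality. The term \<open>p = 0\<close> has weight 0, so
  the index set may be enlarged to all naturals, and for each \<open>M\<close> only
  \<open>p = card M\<close> contributes.\<close>

lemma infsum_Hoeffding_proj:
  assumes f: "f \<in> L2_X P \<mu> X"
  shows "(\<Sum>\<^sub>\<infinity>p\<in>{1..}. of_nat p * (\<integral>\<^sup>+\<omega>. ennreal ((Hoeffding_proj P \<mu> X p f \<omega>)\<^sup>2) \<partial>P)) =
    (\<Sum>k. ennreal (derivative_energy f k))"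
proof -
  let ?E = "\<lambda>p. \<integral>\<^sup>+M. w f M * indicator {M. finite M \<and> card M = p} M \<partial>fin_sets"
  have "(\<Sum>\<^sub>\<infinity>p\<in>{1..}. of_nat p * (\<integral>\<^sup>+\<omega>. ennreal ((Hoeffding_proj P \<mu> X p f \<omega>)\<^sup>2) \<partial>P)) =
      (\<Sum>\<^sub>\<infinity>p\<in>UNIV. of_nat p * ?E p)"
    unfolding nn_integral_Hoeffding_proj[OF f]
    by (rule infsum_cong_neutral) (auto simp: not_le)
  also have "\<dots> = (\<Sum>p. of_nat p * ?E p)"
    using nn_integral_count_space_eq_infsum[of "UNIV::nat set" "\<lambda>p. of_nat p * ?E p"]
    by (simp add: nn_integral_count_space_nat)
  also have "\<dots> = (\<Sum>p. \<integral>\<^sup>+M. of_nat p * (w f M * indicator {M. finite M \<and> card M = p} M) \<partial>fin_sets)"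
    by (simp add: nn_integral_cmult)
  also have "\<dots> = (\<integral>\<^sup>+M. (\<Sum>p. of_nat p * (w f M * indicator {M. finite M \<and> card M = p} M)) \<partial>fin_sets)"
    by (rule nn_integral_suminf[symmetric]) simp
  also have "\<dots> = (\<integral>\<^sup>+M. of_nat (card M) * w f M \<partial>fin_sets)"
  proof (rule nn_integral_cong)
    fix M assume "M \<in> space fin_sets"
    then have M: "finite M" by simp
    have "(\<Sum>p. of_nat p * (w f M * indicator {M. finite M \<and> card M = p} M)) =
        (\<Sum>p\<in>{card M}. of_nat p * (w f M * indicator {M. finite M \<and> card M = p} M))"
      by (rule suminf_finite) auto
    then show "(\<Sum>p. of_nat p * (w f M * indicator {M. finite M \<and> card M = p} M)) = of_nat (card M) * w f M"
      using M by simp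
  qed
  finally show ?thesis unfolding suminf_derivative_energy_eq[OF f] .
qed

end

theorem proposition2p5:
  fixes P :: "'w measure"
    and \<mu> :: "nat \<Rightarrow> 'a measure"
    and X X' :: "'w \<Rightarrow> nat \<Rightarrow> 'a"
    and F :: "'w \<Rightarrow> real"
  assumes "prob_space P"
    and "\<And>n. prob_space (\<mu> n)"
    and "prob_space.indep_var P (PiM UNIV \<mu>) X (PiM UNIV \<mu>) X'"
    and "distr P (PiM UNIV \<mu>) X = PiM UNIV \<mu>"
    and "distr P (PiM UNIV \<mu>) X' = PiM UNIV \<mu>"
    and "F \<in> L2_X P \<mu> X"
  defines "cond_i \<equiv> F \<in> dom_D P \<mu> X"
    and "cond_ii \<equiv> D_seq P \<mu> X F \<in> L2 (kappa_P_X P \<mu> X)"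
    and "cond_ii_sum \<equiv> (\<Sum>k. \<integral>\<^sup>+\<omega>. ennreal ((Dk P \<mu> X k F \<omega>)\<^sup>2) \<partial>P) < \<infinity>"
    and "cond_iii_one \<equiv> \<exists>f. representative P \<mu> X F f \<and>
           (\<Sum>k. \<integral>\<^sup>+\<omega>. ennreal ((f ((X \<omega>)(k := X' \<omega> k)) - f (X \<omega>))\<^sup>2) \<partial>P) < \<infinity>"
    and "cond_iii_every \<equiv> \<forall>f. representative P \<mu> X F f \<longrightarrow>
           (\<Sum>k. \<integral>\<^sup>+\<omega>. ennreal ((f ((X \<omega>)(k := X' \<omega> k)) - f (X \<omega>))\<^sup>2) \<partial>P) < \<infinity>"
    and "cond_iv \<equiv>
           (\<Sum>\<^sub>\<infinity>p\<in>{1..}. of_nat p * (\<integral>\<^sup>+\<omega>. ennreal ((Hoeffding_proj P \<mu> X p F \<omega>)\<^sup>2) \<partial>P)) =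
           (\<Sum>\<^sub>\<infinity>M\<in>{M. finite M}.
              of_nat (card M) * (\<integral>\<^sup>+\<omega>. ennreal ((Hoeffding_component P \<mu> X F M \<omega>)\<^sup>2) \<partial>P)) \<and>
           (\<Sum>\<^sub>\<infinity>M\<in>{M. finite M}.
              of_nat (card M) * (\<integral>\<^sup>+\<omega>. ennreal ((Hoeffding_component P \<mu> X F M \<omega>)\<^sup>2) \<partial>P)) < \<infinity>"
  shows "(cond_i \<longleftrightarrow> cond_ii) \<and> (cond_ii \<longleftrightarrow> cond_ii_sum) \<and>
         (cond_i \<longleftrightarrow> cond_iii_one) \<and> (cond_i \<longleftrightarrow> cond_iii_every) \<and>
         (cond_i \<longleftrightarrow> cond_iv)"
proof -
  interpret prob_space P by fact
  have X: "X \<in> P \<rightarrow>\<^sub>M PiM UNIV \<mu>" using assms(3) by (rule indep_var_rv1)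
  interpret product_sequence P \<mu> X
    by (intro product_sequence.intro product_sequence_axioms.intro assms(1,2,4) X)
  note F = assms(6)
  define fin where "fin \<longleftrightarrow> (\<Sum>k. ennreal (derivative_energy F k)) < \<infinity>"
  have "cond_i \<longleftrightarrow> fin"
    unfolding cond_i_def fin_def
    using suminf_derivative_energy_finite_imp_dom_D[OF F] dom_D_imp_suminf_d_finite by blast
  moreover have "cond_ii \<longleftrightarrow> fin"
    unfolding cond_ii_def fin_def by (rule D_seq_L2_iff[OF F])
  moreover have "cond_ii_sum \<longleftrightarrow> fin"
    unfolding cond_ii_sum_def fin_def nn_integral_D_square[OF F] ..
  moreover have "cond_iii_one \<longleftrightarrow> fin" "cond_iii_every \<longleftrightarrow> fin"
  proof -
    \<comment> \<open>One representative exists and all of them give the same criterion, so the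
      existential and the universal form agree.\<close>
    obtain f where "representative P \<mu> X F f" by (rule representative_exists[OF F])
    then show "cond_iii_one \<longleftrightarrow> fin" "cond_iii_every \<longleftrightarrow> fin"
      using suminf_resample_finite_iff[OF assms(3,5) F]
      by (auto simp: cond_iii_one_def cond_iii_every_def fin_def)
  qed
  \<comment> \<open>The equality in (iv) holds in [0,\<infinity>] for every F in the space, so the
    condition reduces to its finiteness part.\<close>
  moreover have "cond_iv \<longleftrightarrow> fin"
    unfolding cond_iv_def fin_def infsum_Hoeffding_proj[OF F] infsum_card_component_energy[OF F] by blast
  ultimately show ?thesis by blast
qed

end
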